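(* Consider an $\llbracket n,k\rrbracket$ stabilizer code on $m$-dimensional qudits together with a partition $[n]=Q_1\cup\dots\cup Q_N$ of its qudits into disjoint non-empty subsets, and let $d_\downarrow$, $d_\uparrow$ and $\Delta$ be the min-distance, max-distance and disjointness of the code with respect to this partition. If $M$ is a positive integer satisfying $$d_\uparrow< d_\downarrow\,\Delta^{M-1},$$ then every transversal logical operator of the code (with respect to the partition $\{Q_i\}$) is in the $M$-th level $\overline C_M$ of the Clifford hierarchy of the logical Pauli group.
   Context: Fix a qudit dimension $m\ge2$, $\omega_m=e^{2\pi i/m}$, $X=\sum_{l}|l\oplus1\rangle\langle l|$ (addition mod $m$), $Z=\sum_l\omega_m^l|l\rangle\langle l|$. $\mathcal P_n$ is the group generated by the single-qudit $X$'s and $Z$'s on $n$ qudits (for $m=2$ one may also include $Y=iXZ$ among the generators). The group commutator is $[A,B]=ABA^\dagger B^\dagger$. Stabilizer code: an $\llbracket n,k\rrbracket$ code ($k\ge1$) is given by a group $\mathcal S=\langle s_1,\dots,s_{n-k}\rangle\subseteq\mathcal P_n$ of mutually commuting Paulis with $|\mathcal S|=m^{n-k}$; its code space $\mathcal C\subseteq(\mathbb C^m)^{\otimes n}$ is the simultaneous $+1$ eigenspace of $\mathcal S$, of dimension $m^k$. A logical operator is a unitary on $(\mathbb C^m)^{\otimes n}$ mapping $\mathcal C$ to $\mathcal C$; it is trivial if it acts as a scalar on $\mathcal C$. Logical Pauli generators $\bar X_i,\bar Z_i\in\mathcal P_n$ ($1\le i\le k$) commute with $\mathcal S$ and satisfy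 $[\bar X_i,\bar Z_j]=\omega_m^{-\delta_{ij}}I$, $[\bar X_i,\bar X_j]=[\bar Z_i,\bar Z_j]=I$. The set of non-trivial logical Paulis is the set of cosets $$\mathcal L=\Big\{\mathcal S\prod_{i=1}^k\bar X_i^{a_i}\bar Z_i^{a_{i+k}}:a\in\{0,\dots,m-1\}^{2k}\setminus\{0\}\Big\};$$ elements $g\in G\in\mathcal L$ are called representatives of $G$. Partition, transversality, support: a unitary $U$ is transversal if $U=\bigotimes_{i=1}^NU_i$ with $U_i$ acting only on the qudits of $Q_i$. $\mathrm{supp}(U)\subseteq[N]$ is the set of indices $i$ such that $U$ acts non-trivially (i.e. not as a scalar multiple of the identity) on $Q_i$. Distances: $d(G)=\min_{g\in G}|\mathrm{supp}(g)|$, $d_\downarrow=\min_{G\in\mathcal L}d(G)$, $d_\uparrow=\max_{G\in\mathcal L}d(G)$. Disjointness: for an integer $c\ge1$, a set $A\subseteq G$ is $c$-disjoint if for every $i\in[N]$ at most $c$ elements $a\in A$ have $i\in\mathrm{supp}(a)$. Put $\Delta_c(G)=\frac1c\max\{|A|:A\subseteq G\ c\text{-disjoint}\}$ and $\Delta=\max_{c\ge1}\min_{G\in\mathcal L}\Delta_c(G)$. Clifford hierarchy: for a Pauli group $\mathcal P$, $C_1(\mathcal P)=\mathcal P$ and $C_M(\mathcal P)=\{U \text{ unitary}:[U,p]\in C_{M-1}(\mathcal P)\ \forall p\in\mathcal P\}$, where unitaries are considered up to global phase. $\overline C_M$ is this hierarchy for the logical Pauli group: a logical operator is in $\overline C_M$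 if the $k$-qudit unitary it induces on $\mathcal C$ (identified with $(\mathbb C^m)^{\otimes k}$ via $\bar X_i,\bar Z_i$) lies in $C_M(\mathcal P_k)$ up to global phase. *)

theory Defs
  imports
    "HOL-Analysis.Analysis"
    "HOL-Algebra.Coset"
    "HOL-Algebra.Generated_Groups"
    "HOL-Library.Disjoint_Sets"
    "Berlekamp_Zassenhaus.Finite_Field"
begin

text \<open>
  The qudit dimension \<open>m\<close> is \<open>CARD('m)\<close>; class \<open>nontriv\<close> means \<open>m \<ge> 2\<close>, and \<open>'m mod_ring\<close> is
  the ring of integers mod \<open>m\<close>. A register whose qudits are indexed by the finite type \<open>'q\<close> has
  the computational basis \<open>'q \<Rightarrow> 'm mod_ring\<close>, so its state space is the tensor power of
  dimension \<open>m ^ CARD('q)\<close>. The number of physical qudits is \<open>n = CARD('n)\<close>, the number of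
  logical qudits is \<open>k = CARD('k)\<close>, and \<open>k \<ge> 1\<close> since types are non-empty.
\<close>

type_synonym ('q, 'm) ket = "complex ^ ('q \<Rightarrow> 'm mod_ring)"
type_synonym ('q, 'm) qop = "complex ^ ('q \<Rightarrow> 'm mod_ring) ^ ('q \<Rightarrow> 'm mod_ring)"

definition dagger :: "complex ^ 'a ^ 'b \<Rightarrow> complex ^ 'b ^ 'a" where
  "dagger A = map_matrix cnj (transpose A)"

definition unitary :: "complex ^ 'a ^ 'a \<Rightarrow> bool" where
  "unitary U \<longleftrightarrow> dagger U ** U = mat 1 \<and> U ** dagger U = mat 1"

definition unitary_group :: "(complex ^ 'a ^ 'a) monoid" where
  "unitary_group = \<lparr>carrier = {U. unitary U}, monoid.mult = (**), one = mat 1\<rparr>"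

definition group_comm :: "complex ^ 'a ^ 'a \<Rightarrow> complex ^ 'a ^ 'a \<Rightarrow> complex ^ 'a ^ 'a" where
  "group_comm A B = A ** B ** dagger A ** dagger B"

text \<open>
  Product of a finite family of operators. It is only applied to families of pairwise commuting
  operators, for which it does not depend on the order of the factors.
\<close>

definition op_prod :: "('i \<Rightarrow> complex ^ 'a ^ 'a) \<Rightarrow> 'i set \<Rightarrow> complex ^ 'a ^ 'a" where
  "op_prod A I = Finite_Set.fold (\<lambda>i B. A i ** B) (mat 1) I"

subsection \<open>Pauli groups and the Clifford hierarchy\<close>

definition omega :: "nat \<Rightarrow> complex" where
  "omega m = exp (2 * of_real pi * \<i> / of_nat m)"

definition pauli_X :: "'q::finite \<Rightarrow> ('q, 'm::nontriv) qop" where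
  "pauli_X j = (\<chi> f g. if f = g(j := g j + 1) then 1 else 0)"

definition pauli_Z :: "'q::finite \<Rightarrow> ('q, 'm::nontriv) qop" where
  "pauli_Z j = (\<chi> f g. if f = g then omega CARD('m) powi to_int_mod_ring (g j) else 0)"

text \<open>
  The flag \<open>y\<close> records whether, for \<open>m = 2\<close>, the operators \<open>Y = \<i>XZ\<close> are included among the
  generators; it has no effect for \<open>m > 2\<close>.
\<close>

definition pauli_gens :: "bool \<Rightarrow> ('q::finite, 'm::nontriv) qop set" where
  "pauli_gens y = range pauli_X \<union> range pauli_Z \<union>
     (if y \<and> CARD('m) = 2 then range (\<lambda>j. mat \<i> ** pauli_X j ** pauli_Z j) else {})"

definition pauli_group :: "bool \<Rightarrow> ('q::finite, 'm::nontriv) qop set" where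
  "pauli_group y = generate unitary_group (pauli_gens y)"

text \<open>
  Levels are numbered from 1; level 0 is a dummy value. The first level is closed under global
  phases explicitly; the higher levels then are as well, since the commutator ignores phases.
\<close>

fun clifford_level :: "bool \<Rightarrow> nat \<Rightarrow> ('q::finite, 'm::nontriv) qop set" where
  "clifford_level y 0 = {}"
| "clifford_level y (Suc 0) = {mat c ** p | c p. cmod c = 1 \<and> p \<in> pauli_group y}"
| "clifford_level y (Suc (Suc M)) =
     {U. unitary U \<and> (\<forall>p \<in> pauli_group y. group_comm U p \<in> clifford_level y (Suc M))}"

subsection \<open>Stabilizer codes\<close>

definition code_space :: "('n::finite, 'm::nontriv) qop set \<Rightarrow> ('n, 'm) ket set" where
  "code_space S = {v. \<forall>s \<in> S. s *v v = v}"

definition stabilizer_code :: "bool \<Rightarrow> ('n::finite, 'm::nontriv) qop set \<Rightarrow> nat \<Rightarrow> bool" where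
  "stabilizer_code y S k \<longleftrightarrow>
     k \<le> CARD('n) \<and>
     (\<exists>gs. length gs = CARD('n) - k \<and> set gs \<subseteq> pauli_group y \<and>
        S = generate unitary_group (set gs)) \<and>
     (\<forall>s \<in> S. \<forall>t \<in> S. s ** t = t ** s) \<and>
     card S = CARD('m) ^ (CARD('n) - k) \<and>
     vec.dim (code_space S) = CARD('m) ^ k"

definition logical_generators ::
  "bool \<Rightarrow> ('n::finite, 'm::nontriv) qop set \<Rightarrow> ('k::finite \<Rightarrow> ('n, 'm) qop) \<Rightarrow>
   ('k \<Rightarrow> ('n, 'm) qop) \<Rightarrow> bool" where
  "logical_generators y S Xb Zb \<longleftrightarrow>
     (\<forall>i. Xb i \<in> pauli_group y \<and> Zb i \<in> pauli_group y) \<and>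
     (\<forall>i. \<forall>s \<in> S. Xb i ** s = s ** Xb i \<and> Zb i ** s = s ** Zb i) \<and>
     (\<forall>i j. group_comm (Xb i) (Zb j) =
        mat (if i = j then inverse (omega CARD('m)) else 1)) \<and>
     (\<forall>i j. group_comm (Xb i) (Xb j) = mat 1 \<and> group_comm (Zb i) (Zb j) = mat 1)"

text \<open>
  A Pauli exponent vector of length \<open>2k\<close> is given by its two halves \<open>a\<close> and \<open>b\<close>. The factors
  for distinct \<open>i\<close> commute.
\<close>

definition logical_pauli ::
  "('k::finite \<Rightarrow> ('n::finite, 'm::nontriv) qop) \<Rightarrow> ('k \<Rightarrow> ('n, 'm) qop) \<Rightarrow>
   ('k \<Rightarrow> nat) \<Rightarrow> ('k \<Rightarrow> nat) \<Rightarrow> ('n, 'm) qop" where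
  "logical_pauli Xb Zb a b =
     op_prod (\<lambda>i. (Xb i [^]\<^bsub>unitary_group\<^esub> a i) ** (Zb i [^]\<^bsub>unitary_group\<^esub> b i)) UNIV"

definition nontrivial_logical_paulis ::
  "('n::finite, 'm::nontriv) qop set \<Rightarrow> ('k::finite \<Rightarrow> ('n, 'm) qop) \<Rightarrow>
   ('k \<Rightarrow> ('n, 'm) qop) \<Rightarrow> ('n, 'm) qop set set" where
  "nontrivial_logical_paulis S Xb Zb =
     {S #>\<^bsub>unitary_group\<^esub> logical_pauli Xb Zb a b | a b.
        (\<forall>i. a i < CARD('m) \<and> b i < CARD('m)) \<and> (\<exists>i. a i \<noteq> 0 \<or> b i \<noteq> 0)}"

definition logical_operator :: "('n::finite, 'm::nontriv) qop set \<Rightarrow> ('n, 'm) qop \<Rightarrow> bool" where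
  "logical_operator S U \<longleftrightarrow> unitary U \<and> (\<forall>v \<in> code_space S. U *v v \<in> code_space S)"

text \<open>
  \<open>V\<close> is an isometry from the \<open>k\<close>-qudit space onto the code space under which the logical
  generators correspond to the physical ones. The correspondence is up to phases: an
  exact one need not exist, e.g. when \<open>m = 2\<close> and the square of \<open>Xb i\<close> is \<open>-1\<close>.
\<close>

definition code_identification ::
  "('n::finite, 'm::nontriv) qop set \<Rightarrow> ('k::finite \<Rightarrow> ('n, 'm) qop) \<Rightarrow>
   ('k \<Rightarrow> ('n, 'm) qop) \<Rightarrow>
   complex ^ ('k \<Rightarrow> 'm mod_ring) ^ ('n \<Rightarrow> 'm mod_ring) \<Rightarrow> bool" where
  "code_identification S Xb Zb V \<longleftrightarrow>
     dagger V ** V = mat 1 \<and>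
     range ((*v) V) = code_space S \<and>
     (\<forall>i. \<exists>c. cmod c = 1 \<and> Xb i ** V = mat c ** V ** pauli_X i) \<and>
     (\<forall>i. \<exists>c. cmod c = 1 \<and> Zb i ** V = mat c ** V ** pauli_Z i)"

text \<open>
  The identification \<open>V\<close> is unique up to a global phase and a Pauli operator, which does not affect
  membership in a level of the hierarchy; we therefore ask for its existence and let the
  condition range over all identifications.
\<close>

definition logical_clifford_level ::
  "bool \<Rightarrow> ('n::finite, 'm::nontriv) qop set \<Rightarrow> ('k::finite \<Rightarrow> ('n, 'm) qop) \<Rightarrow>
   ('k \<Rightarrow> ('n, 'm) qop) \<Rightarrow> nat \<Rightarrow> ('n, 'm) qop set" where
  "logical_clifford_level y S Xb Zb M =
     {U. logical_operator S U \<and>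
         (\<exists>V. code_identification S Xb Zb V) \<and>
         (\<forall>V. code_identification S Xb Zb V \<longrightarrow> dagger V ** U ** V \<in> clifford_level y M)}"

subsection \<open>Partitions, supports and distances\<close>

definition qudit_partition :: "(nat \<Rightarrow> 'n set) \<Rightarrow> nat \<Rightarrow> bool" where
  "qudit_partition Q N \<longleftrightarrow>
     (\<Union>i\<in>{1..N}. Q i) = UNIV \<and> disjoint_family_on Q {1..N} \<and> (\<forall>i\<in>{1..N}. Q i \<noteq> {})"

text \<open>\<open>U\<close> is the tensor product of an operator \<open>u\<close> on the qudits in \<open>R\<close> with the identity.\<close>

definition acts_only_on :: "'n::finite set \<Rightarrow> ('n, 'm::nontriv) qop \<Rightarrow> bool" where
  "acts_only_on R U \<longleftrightarrow>
     (\<exists>u. \<forall>f g. U $ f $ g =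
        (if \<forall>j. j \<notin> R \<longrightarrow> f j = g j then u (restrict f R) (restrict g R) else 0))"

text \<open>
  The tensor product of operators on the single blocks is the product of their (commuting)
  extensions to the whole register.
\<close>

definition transversal ::
  "(nat \<Rightarrow> 'n::finite set) \<Rightarrow> nat \<Rightarrow> ('n, 'm::nontriv) qop \<Rightarrow> bool" where
  "transversal Q N U \<longleftrightarrow>
     (\<exists>A. (\<forall>i\<in>{1..N}. unitary (A i) \<and> acts_only_on (Q i) (A i)) \<and> U = op_prod A {1..N})"

text \<open>An operator is a scalar on \<open>Q i\<close> iff it acts only on the qudits outside \<open>Q i\<close>.\<close>

definition supp :: "(nat \<Rightarrow> 'n::finite set) \<Rightarrow> nat \<Rightarrow> ('n, 'm::nontriv) qop \<Rightarrow> nat set" where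
  "supp Q N U = {i \<in> {1..N}. \<not> acts_only_on (- Q i) U}"

definition coset_distance ::
  "(nat \<Rightarrow> 'n::finite set) \<Rightarrow> nat \<Rightarrow> ('n, 'm::nontriv) qop set \<Rightarrow> nat" where
  "coset_distance Q N G = Min ((\<lambda>g. card (supp Q N g)) ` G)"

definition min_distance ::
  "(nat \<Rightarrow> 'n::finite set) \<Rightarrow> nat \<Rightarrow> ('n, 'm::nontriv) qop set set \<Rightarrow> nat" where
  "min_distance Q N L = Min (coset_distance Q N ` L)"

definition max_distance ::
  "(nat \<Rightarrow> 'n::finite set) \<Rightarrow> nat \<Rightarrow> ('n, 'm::nontriv) qop set set \<Rightarrow> nat" where
  "max_distance Q N L = Max (coset_distance Q N ` L)"

definition c_disjoint ::
  "(nat \<Rightarrow> 'n::finite set) \<Rightarrow> nat \<Rightarrow> nat \<Rightarrow> ('n, 'm::nontriv) qop set \<Rightarrow> bool" where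
  "c_disjoint Q N c A \<longleftrightarrow> (\<forall>i\<in>{1..N}. card {a \<in> A. i \<in> supp Q N a} \<le> c)"

definition c_disjointness ::
  "(nat \<Rightarrow> 'n::finite set) \<Rightarrow> nat \<Rightarrow> nat \<Rightarrow> ('n, 'm::nontriv) qop set \<Rightarrow> real" where
  "c_disjointness Q N c G = real (Max {card A | A. A \<subseteq> G \<and> c_disjoint Q N c A}) / real c"

text \<open>
  The supremum is a maximum: for a coset \<open>G\<close> of a finite group, the \<open>c\<close>-disjointness is at most
  \<open>card G / c\<close>, so only finitely many \<open>c\<close> exceed the positive value at \<open>c = 1\<close>.
\<close>

definition disjointness ::
  "(nat \<Rightarrow> 'n::finite set) \<Rightarrow> nat \<Rightarrow> ('n, 'm::nontriv) qop set set \<Rightarrow> real" where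
  "disjointness Q N L = (SUP c\<in>{1..}. Min (c_disjointness Q N c ` L))"

end

theory Submission
  imports Defs "HOL-Library.Function_Algebras"
begin

text \<open>
  For a transversal \<open>K\<close> and a Pauli operator \<open>p\<close>, the commutator \<open>[K, p]\<close> is supported on the intersection
  of the two supports. Commuting first with a lightest representative of a logical Pauli class leaves
  a support of size at most the max-distance. In every later step, averaging over a \<open>c\<close>-disjoint
  set of representatives of the class yields one for which the support shrinks by the factor \<open>\<Delta>\<close>. After
  \<open>M\<close> commutators the support is smaller than the min-distance; such an operator acts as a scalar on
  the code space, because each Weyl operator in its expansion either fails to commute with the stabilizer,
  hence has zero compression, or is a stabilizer up to a phase. So all \<open>M\<close>-fold commutators with logical Paulis
  are scalars, which is membership in level \<open>M\<close>.
\<close>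

subsection \<open>Operators\<close>

lemma mat_vec_index: "(mat c :: complex^'a::finite^'a) $ i $ j = (if i = j then c else 0)"
  by (simp add: mat_def)

lemma mat_mult_index [simp]: "(mat c ** (A :: complex^'a::finite^'b::finite)) $ i $ j = c * A $ i $ j"
  by (simp add: matrix_matrix_mult_def mat_def if_distrib[of "\<lambda>x. x * _"] sum.delta cong: if_cong)

lemma mult_mat_index: "((A :: complex^'a::finite^'b::finite) ** mat c) $ i $ j = c * A $ i $ j"
  by (simp add: matrix_matrix_mult_def mat_def if_distrib[of "\<lambda>x. _ * x"] sum.delta' cong: if_cong)

lemma mat_central: "(A :: complex^'a::finite^'b::finite) ** mat c = mat c ** A"
  by (simp add: vec_eq_iff mult_mat_index)

lemma mat_mult_mat: "mat c ** (mat d :: complex^'a::finite^'a) = mat (c * d)"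
  by (simp add: vec_eq_iff mat_vec_index)

lemma mat_mult_mat_left: "mat c ** (mat d ** (A :: complex^'a::finite^'b::finite)) = mat (c * d) ** A"
  by (simp add: vec_eq_iff)

lemma mult_mat_left: "(A :: complex^'a::finite^'b::finite) ** (mat c ** B) = mat c ** (A ** (B :: complex^'d::finite^'a))"
  by (metis mat_central matrix_mul_assoc)

lemma mat_mult_assoc: "(mat c ** A) ** B = mat c ** ((A :: complex^'a::finite^'b::finite) ** (B :: complex^'d::finite^'a))"
  by (simp add: matrix_mul_assoc)

lemma mat_vector_mult: "((mat c :: complex^'a::finite^'a) *v v) = c *s v"
  by (simp add: vec_eq_iff matrix_vector_mult_def mat_def if_distrib[of "\<lambda>x. x * _"] sum.delta cong: if_cong)

lemma mat_vec_mult: "((mat c ** A) *v v) = c *s ((A :: complex^'a::finite^'b::finite) *v v)"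
  by (metis mat_vector_mult matrix_vector_mul_assoc)

lemma dagger_index [simp]: "dagger A $ i $ j = cnj (A $ j $ i)"
  by (simp add: dagger_def map_matrix_def transpose_def)

lemma dagger_dagger [simp]: "dagger (dagger A) = A"
  by (simp add: vec_eq_iff)

lemma dagger_mult: "dagger (A ** B) = dagger B ** dagger (A :: complex^'a::finite^'b::finite)"
  by (simp add: vec_eq_iff matrix_matrix_mult_def mult.commute)

lemma dagger_mat [simp]: "dagger (mat c :: complex^'a::finite^'a) = mat (cnj c)"
  by (auto simp: vec_eq_iff mat_vec_index)

lemma unitaryD: "unitary U \<Longrightarrow> dagger U ** U = mat 1" "unitary U \<Longrightarrow> U ** dagger U = mat 1"
  by (auto simp: unitary_def)

lemma unitaryI: "dagger U ** U = mat 1 \<Longrightarrow> unitary (U :: complex^'a::finite^'a)"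
  using matrix_left_right_inverse[of "dagger U" U] by (auto simp: unitary_def)

lemma unitary_mat: "cmod c = 1 \<Longrightarrow> unitary (mat c :: complex^'a::finite^'a)"
  by (auto simp: unitary_def mat_mult_mat complex_norm_square[symmetric] mult.commute)

lemma unitary_one [simp]: "unitary (mat 1 :: complex^'a::finite^'a)"
  by (simp add: unitary_mat)

lemma cancel_dagger:
  assumes "unitary (U :: complex^'a::finite^'a)"
  shows "dagger U ** (U ** A) = A" "U ** (dagger U ** A) = A"
    "(B ** dagger U) ** U = B" "(B ** U) ** dagger U = B"
  using unitaryD[OF assms] by (simp_all add: matrix_mul_assoc) (simp_all add: matrix_mul_assoc[symmetric])

lemma unitary_mult: "unitary A \<Longrightarrow> unitary B \<Longrightarrow> unitary (A ** (B :: complex^'a::finite^'a))"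
  by (auto intro!: unitaryI simp: dagger_mult matrix_mul_assoc[symmetric] cancel_dagger unitaryD)

lemma unitary_dagger: "unitary A \<Longrightarrow> unitary (dagger A)"
  by (simp add: unitary_def)

lemma unitary_comm: "unitary A \<Longrightarrow> unitary B \<Longrightarrow> unitary (group_comm A (B :: complex^'a::finite^'a))"
  by (simp add: group_comm_def unitary_mult unitary_dagger)

lemma unitary_norm_eq_1:
  assumes "unitary (mat c :: complex^'a::finite^'a)"
  shows "cmod c = 1"
proof -
  have "(mat (cnj c * c) :: complex^'a^'a) = mat 1"
    using unitaryD(1)[OF assms] by (simp add: mat_mult_mat)
  then have "(mat (cnj c * c) :: complex^'a^'a) $ undefined $ undefined = (mat 1 :: complex^'a^'a) $ undefined $ undefined"
    by (rule arg_cong)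
  then have "of_real ((cmod c)\<^sup>2) = (1::complex)"
    by (simp add: mat_vec_index complex_norm_square mult.commute del: of_real_power)
  then have "(cmod c)\<^sup>2 = 1" using of_real_eq_1_iff by blast
  then show ?thesis by (simp add: power2_eq_1_iff) (use norm_ge_zero[of c] in linarith)
qed

lemma group_comm_eq_iff:
  assumes "unitary A" "unitary (B :: complex^'a::finite^'a)"
  shows "group_comm A B = mat c \<longleftrightarrow> A ** B = mat c ** (B ** A)"
proof
  assume "group_comm A B = mat c"
  then have "(A ** B ** dagger A ** dagger B) ** B ** A = mat c ** B ** A"
    by (simp add: group_comm_def)
  then show "A ** B = mat c ** (B ** A)"
    by (simp add: cancel_dagger assms matrix_mul_assoc)
next
  assume "A ** B = mat c ** (B ** A)"
  then have "group_comm A B = mat c ** (B ** A ** dagger A ** dagger B)"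
    by (simp add: group_comm_def matrix_mul_assoc)
  then show "group_comm A B = mat c"
    by (simp add: cancel_dagger assms unitaryD)
qed

lemma group_unitary_group: "group (unitary_group :: (complex^'a::finite^'a) monoid)"
proof (rule groupI)
  fix x :: "complex^'a^'a" assume "x \<in> carrier unitary_group"
  then show "\<exists>y\<in>carrier unitary_group. y \<otimes>\<^bsub>unitary_group\<^esub> x = \<one>\<^bsub>unitary_group\<^esub>"
    by (intro bexI[of _ "dagger x"]) (auto simp: unitary_group_def unitary_dagger unitaryD)
qed (auto simp: unitary_group_def unitary_mult matrix_mul_assoc)

lemma unitary_group_simps [simp]:
  "carrier unitary_group = {U. unitary U}" "x \<otimes>\<^bsub>unitary_group\<^esub> y = x ** y"
  "\<one>\<^bsub>unitary_group\<^esub> = mat 1"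
  by (auto simp: unitary_group_def)

lemma inv_unitary_group: "unitary x \<Longrightarrow> inv\<^bsub>unitary_group\<^esub> (x :: complex^'a::finite^'a) = dagger x"
  using group.inv_equality[OF group_unitary_group, of "dagger x" x]
  by (simp add: unitaryD unitary_dagger)

lemma generate_unitary_induct:
  assumes "x \<in> generate unitary_group H" "H \<subseteq> {U. unitary (U :: complex^'a::finite^'a)}"
    and "P (mat 1)" "\<And>h. h \<in> H \<Longrightarrow> P h" "\<And>h. h \<in> H \<Longrightarrow> P (dagger h)"
    and "\<And>a b. P a \<Longrightarrow> P b \<Longrightarrow> P (a ** b)"
  shows "P x"
  using assms(1)
proof induction
  case (inv h)
  then show ?case using assms(2) assms(5)[of h] by (subst inv_unitary_group) auto
qed (use assms(3-) in auto)

section \<open>Products of commuting families\<close>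

lemma comp_fun_commute_on_matrix_mult:
  assumes "\<And>i j. i \<in> I \<Longrightarrow> j \<in> I \<Longrightarrow> A i ** A j = A j ** (A i :: complex^'a::finite^'a)"
  shows "comp_fun_commute_on I (\<lambda>i B. A i ** B)"
  by standard (use assms in \<open>simp add: fun_eq_iff matrix_mul_assoc\<close>)

lemma op_prod_empty [simp]: "op_prod A {} = mat 1"
  by (simp add: op_prod_def)

lemma op_prod_insert:
  assumes "\<And>i j. i \<in> insert k I \<Longrightarrow> j \<in> insert k I \<Longrightarrow> A i ** A j = A j ** (A i :: complex^'a::finite^'a)"
    and "finite I" "k \<notin> I"
  shows "op_prod A (insert k I) = A k ** op_prod A I"
  unfolding op_prod_def
  by (rule comp_fun_commute_on.fold_insert[OF comp_fun_commute_on_matrix_mult[of "insert k I"]])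
     (use assms in auto)

lemma op_prod_remove:
  assumes "\<And>i j. i \<in> I \<Longrightarrow> j \<in> I \<Longrightarrow> A i ** A j = A j ** (A i :: complex^'a::finite^'a)"
    and "finite I" "k \<in> I"
  shows "op_prod A I = A k ** op_prod A (I - {k})"
  using op_prod_insert[where k = k and I = "I - {k}" and A = A] assms by (simp add: insert_absorb)

lemma op_prod_cong:
  assumes "\<And>i j. i \<in> I \<Longrightarrow> j \<in> I \<Longrightarrow> A i ** A j = A j ** (A i :: complex^'a::finite^'a)"
    and "finite I" "\<And>i. i \<in> I \<Longrightarrow> A i = B i"
  shows "op_prod A I = op_prod B I"
  using assms(2,1,3)
proof (induction I)
  case (insert k I)
  then show ?case
    using op_prod_insert[where k = k and I = I and A = A] op_prod_insert[where k = k and I = I and A = B]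
    by (simp add: insert.hyps)
qed simp

text \<open>The predicate also sees the set of factors used so far, so that partial products can be
  compared with partial sums of phase points.\<close>

lemma op_prod_induct:
  assumes "finite I"
    and "\<And>i j. i \<in> I \<Longrightarrow> j \<in> I \<Longrightarrow> A i ** A j = A j ** (A i :: complex^'a::finite^'a)"
    and "P {} (mat 1)"
    and "\<And>k J B. k \<in> I \<Longrightarrow> J \<subseteq> I \<Longrightarrow> finite J \<Longrightarrow> k \<notin> J \<Longrightarrow> P J B \<Longrightarrow> P (insert k J) (A k ** B)"
  shows "P I (op_prod A I)"
proof -
  have "J \<subseteq> I \<Longrightarrow> P J (op_prod A J)" if "finite J" for J
    using that
  proof (induction J)
    case (insert k J)
    have "op_prod A (insert k J) = A k ** op_prod A J"
      by (rule op_prod_insert) (use insert assms(2) in auto)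
    then show ?case using assms(4)[of k J] insert by simp
  qed (use assms in simp)
  with assms(1) show ?thesis by simp
qed

text \<open>Weyl operators are closed under products and adjoints only up to a phase. Modulo phases
  only the arithmetic of phase points remains, and unitarity, supports and commutators are all phase
  invariant.\<close>

definition phase_eq :: "complex^'a^'b \<Rightarrow> complex^'a^'b \<Rightarrow> bool" (infix "\<sim>\<^sub>p" 50) where
  "A \<sim>\<^sub>p B \<longleftrightarrow> (\<exists>c. cmod c = 1 \<and> A = mat c ** B)"

lemma phase_eq_refl [simp]: "A \<sim>\<^sub>p (A :: complex^'a::finite^'b::finite)"
  unfolding phase_eq_def by (rule exI[of _ 1]) simp

lemma phase_eq_sym: "A \<sim>\<^sub>p B \<Longrightarrow> B \<sim>\<^sub>p (A :: complex^'a::finite^'b::finite)"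
proof -
  assume "A \<sim>\<^sub>p B"
  then obtain c where c: "cmod c = 1" "A = mat c ** B" by (auto simp: phase_eq_def)
  then have "c \<noteq> 0" by auto
  with c(2) have "B = mat (inverse c) ** A" by (simp add: mat_mult_mat_left)
  then show ?thesis using c unfolding phase_eq_def by (intro exI[of _ "inverse c"]) (simp add: norm_inverse)
qed

lemma phase_eq_trans [trans]: "A \<sim>\<^sub>p B \<Longrightarrow> B \<sim>\<^sub>p C \<Longrightarrow> A \<sim>\<^sub>p (C :: complex^'a::finite^'b::finite)"
  unfolding phase_eq_def by (metis mat_mult_mat_left norm_mult mult_1)

lemma phase_eq_mult:
  "A \<sim>\<^sub>p B \<Longrightarrow> A' \<sim>\<^sub>p B' \<Longrightarrow> A ** A' \<sim>\<^sub>p (B :: complex^'a::finite^'b::finite) ** (B' :: complex^'d::finite^'a)"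
  unfolding phase_eq_def by (metis mat_mult_assoc mult_mat_left mat_mult_mat_left norm_mult mult_1)

lemma phase_eq_dagger: "A \<sim>\<^sub>p B \<Longrightarrow> dagger A \<sim>\<^sub>p dagger (B :: complex^'a::finite^'b::finite)"
  unfolding phase_eq_def by (metis dagger_mult dagger_mat mat_central complex_mod_cnj)

lemma phase_eq_mat: "cmod c = 1 \<Longrightarrow> mat c ** A \<sim>\<^sub>p (A :: complex^'a::finite^'b::finite)"
  unfolding phase_eq_def by auto

lemma phase_eq_unitary: "A \<sim>\<^sub>p B \<Longrightarrow> unitary B \<Longrightarrow> unitary (A :: complex^'a::finite^'a)"
  unfolding phase_eq_def by (auto intro!: unitary_mult unitary_mat)

lemma dagger_mat_mult: "dagger (mat c ** A) = mat (cnj c) ** dagger (A :: complex^'a::finite^'b::finite)"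
  by (simp add: vec_eq_iff)

text \<open>Each argument occurs once plainly and once under \<open>dagger\<close>, so its phase
  meets the conjugate phase and cancels.\<close>

lemma group_comm_mat:
  assumes "cmod c = 1"
  shows "group_comm (mat c ** A) (B :: complex^'a::finite^'a) = group_comm A B"
    and "group_comm A (mat c ** B) = group_comm A B"
proof -
  have c: "c * cnj c = 1" using assms by (simp add: complex_norm_square[symmetric])
  have "group_comm (mat c ** A) B = (mat c ** (A ** B)) ** (mat (cnj c) ** dagger A) ** dagger B"
    by (simp only: group_comm_def dagger_mat_mult mat_mult_assoc)
  also have "\<dots> = (mat (cnj c) ** (mat c ** (A ** B))) ** (dagger A ** dagger B)"
    by (simp only: mat_central[of _ "cnj c"] matrix_mul_assoc)
  finally show "group_comm (mat c ** A) B = group_comm A B"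
    using c by (simp add: mat_mult_mat group_comm_def matrix_mul_assoc mult.commute)
  have "group_comm A (mat c ** B) = A ** mat c ** B ** dagger A ** mat (cnj c) ** dagger B"
    by (simp only: group_comm_def dagger_mat_mult matrix_mul_assoc)
  also have "\<dots> = mat (cnj c) ** (A ** mat c ** B ** dagger A) ** dagger B"
    by (simp only: mat_central[of _ "cnj c"])
  also have "\<dots> = mat (cnj c) ** (mat c ** A ** B ** dagger A) ** dagger B"
    by (simp only: mat_central[of A c])
  finally show "group_comm A (mat c ** B) = group_comm A B"
    using c by (simp add: mat_mult_mat group_comm_def matrix_mul_assoc mult.commute)
qed

lemma group_comm_phase:
  assumes "A \<sim>\<^sub>p A'" "B \<sim>\<^sub>p (B' :: complex^'a::finite^'a)"
  shows "group_comm A B = group_comm A' B'"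
  using assms by (auto simp: phase_eq_def group_comm_mat)

subsection \<open>Characters of the integers mod m\<close>

text \<open>A faithful additive character of Z_m; the commutation phase of two Paulis is always one
  of its values.\<close>

definition chi :: "'m::nontriv mod_ring \<Rightarrow> complex" where
  "chi x = omega CARD('m) powi to_int_mod_ring x"

definition nat_of :: "'m::nontriv mod_ring \<Rightarrow> nat" where
  "nat_of x = nat (to_int_mod_ring x)"

lemma to_int_mod_ring_bounds:
  "0 \<le> to_int_mod_ring (x :: 'm::nontriv mod_ring)" "to_int_mod_ring x < int CARD('m)"
  using range_to_int_mod_ring[where 'a = 'm] by (auto simp: set_eq_iff)

lemma nat_of_less: "nat_of (x :: 'm::nontriv mod_ring) < CARD('m)"
  using to_int_mod_ring_bounds[of x] by (simp add: nat_of_def)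

lemma int_nat_of: "int (nat_of x) = to_int_mod_ring x"
  using to_int_mod_ring_bounds[of x] by (simp add: nat_of_def)

lemma of_nat_nat_of [simp]: "of_nat (nat_of x) = x"
  by (simp add: of_nat_of_int_mod_ring int_nat_of)

lemma nat_of_of_nat: "a < CARD('m) \<Longrightarrow> nat_of (of_nat a :: 'm::nontriv mod_ring) = a"
  by (simp add: of_nat_of_int_mod_ring nat_of_def)

lemma nat_of_eq_0_iff [simp]: "nat_of x = 0 \<longleftrightarrow> x = 0"
  by (metis of_nat_0 of_nat_nat_of nat_of_of_nat zero_less_card_finite)

lemma nat_of_add:
  "nat_of (x + y) = (nat_of x + nat_of (y :: 'm::nontriv mod_ring)) mod CARD('m)"
proof -
  have "int (nat_of (x + y)) = int ((nat_of x + nat_of y) mod CARD('m))"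
    by (simp add: int_nat_of to_int_mod_ring_add zmod_int)
  then show ?thesis by linarith
qed

lemma nat_of_1 [simp]: "nat_of (1 :: 'm::nontriv mod_ring) = 1"
  using nat_of_of_nat[of 1, where 'm = 'm] nontriv[where 'a = 'm] by simp

lemma omega_power: "m > 0 \<Longrightarrow> omega m ^ j = 1 \<longleftrightarrow> m dvd j"
  using complex_root_unity_eq_1[of m j]
  by (simp add: omega_def exp_of_nat_mult[symmetric] mult_ac)

lemma chi_power: "chi x = omega CARD('m) ^ nat_of (x :: 'm::nontriv mod_ring)"
  using to_int_mod_ring_bounds[of x] by (simp add: chi_def nat_of_def power_int_def)

lemma power_mod_eq:
  assumes "z ^ m = (1::complex)"
  shows "z ^ (n mod m) = z ^ n"
proof -
  have "z ^ n = z ^ (m * (n div m) + n mod m)" by simp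
  then show ?thesis by (simp only: power_add power_mult assms power_one mult_1)
qed

lemma chi_add: "chi (x + y) = chi x * chi (y :: 'm::nontriv mod_ring)"
  by (simp add: chi_power nat_of_add power_mod_eq omega_power power_add)

lemma chi_0 [simp]: "chi 0 = 1"
  by (simp add: chi_power nat_of_def)

lemma chi_1: "chi (1 :: 'm::nontriv mod_ring) = omega CARD('m)"
  by (simp add: chi_power)

lemma chi_eq_1_iff: "chi x = 1 \<longleftrightarrow> (x :: 'm::nontriv mod_ring) = 0"
proof
  assume "chi x = 1"
  then have "CARD('m) dvd nat_of x" by (simp add: chi_power omega_power)
  then have "nat_of x = 0" using nat_of_less[of x] by (metis dvd_imp_le not_le gr0I)
  then show "x = 0" by simp
qed simp

lemma norm_chi [simp]: "cmod (chi x) = 1"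
  by (simp add: chi_power norm_power omega_def)

lemma chi_nonzero [simp]: "chi x \<noteq> 0"
  using norm_chi[of x] by (metis norm_zero zero_neq_one)

lemma chi_minus: "chi (- x) = inverse (chi x)"
  using chi_add[of x "- x"] by (simp add: field_simps)

lemma chi_diff: "chi (x - y) = chi x * inverse (chi y)"
  using chi_add[of x "- y"] by (simp add: chi_minus)

lemma cnj_chi: "cnj (chi x) = chi (- x)"
proof -
  have "chi x * cnj (chi x) = 1"
    by (simp add: complex_norm_square[symmetric])
  then show ?thesis by (simp add: chi_minus field_simps)
qed

lemma chi_inj: "chi x = chi y \<longleftrightarrow> x = y"
  using chi_eq_1_iff[of "x - y"] by (simp add: chi_diff field_simps)

text \<open>Translating the summation variable by x0 multiplies the sum by
  \<open>chi (f x0)\<close>, which is not 1.\<close>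

lemma sum_chi_hom_eq_0:
  fixes f :: "'g::{finite, ab_group_add} \<Rightarrow> 'm::nontriv mod_ring"
  assumes "\<And>x y. f (x + y) = f x + f y" "f x0 \<noteq> 0"
  shows "(\<Sum>x\<in>UNIV. chi (f x)) = 0"
proof -
  have "(\<Sum>x\<in>UNIV. chi (f x)) = (\<Sum>x\<in>UNIV. chi (f (x0 + x)))"
    by (rule sum.reindex_bij_witness[of _ "\<lambda>x. x0 + x" "\<lambda>x. x - x0"]) auto
  also have "\<dots> = chi (f x0) * (\<Sum>x\<in>UNIV. chi (f x))"
    by (simp add: assms(1) chi_add sum_distrib_left)
  finally show ?thesis using assms(2) by (simp add: chi_eq_1_iff)
qed

subsection \<open>Weyl operators\<close>

type_synonym ('q, 'm) phase_point = "('q \<Rightarrow> 'm mod_ring) \<times> ('q \<Rightarrow> 'm mod_ring)"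

definition dot :: "('q::finite \<Rightarrow> 'm::nontriv mod_ring) \<Rightarrow> ('q \<Rightarrow> 'm mod_ring) \<Rightarrow> 'm mod_ring" where
  "dot b g = (\<Sum>j\<in>UNIV. b j * g j)"

lemma dot_add: "dot (b + c) g = dot b g + dot c g" "dot b (g + h) = dot b g + dot b h"
  by (simp_all add: dot_def algebra_simps sum.distrib)

lemma dot_0 [simp]: "dot 0 g = 0" "dot b 0 = 0"
  by (simp_all add: dot_def)

lemma dot_minus: "dot (- b) g = - dot b g" "dot b (- g) = - dot b g"
  by (simp_all add: dot_def sum_negf)

lemma dot_diff: "dot (b - c) g = dot b g - dot c g" "dot b (g - h) = dot b g - dot b h"
  by (simp_all add: dot_def algebra_simps sum_subtractf)

definition single :: "'q \<Rightarrow> 'm::nontriv mod_ring \<Rightarrow> ('q \<Rightarrow> 'm mod_ring)" where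
  "single j x = (\<lambda>i. if i = j then x else 0)"

lemma dot_single [simp]: "dot (single j x) g = x * g j" "dot b (single j x) = b j * x"
  by (simp_all add: dot_def single_def if_distrib[of "\<lambda>x. x * _"] if_distrib[of "\<lambda>x. _ * x"]
      sum.delta sum.delta' cong: if_cong)

text \<open>For u = (a, b) this is X^a Z^b: the basis state g goes to g + a with phase chi(b.g).
  Without a symmetrizing phase all nonzero entries are values of \<open>chi\<close>, for even m as
  well.\<close>

definition weyl :: "('q::finite, 'm::nontriv) phase_point \<Rightarrow> ('q, 'm) qop" where
  "weyl u = (\<chi> f g. if f = g + fst u then chi (dot (snd u) g) else 0)"

lemma weyl_index: "weyl u $ f $ g = (if f = g + fst u then chi (dot (snd u) g) else 0)"
  by (simp add: weyl_def)

lemma mult_weyl_index: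
  "((A :: complex^('q::finite \<Rightarrow> 'm::nontriv mod_ring)^'a::finite) ** weyl u) $ f $ g
     = A $ f $ (g + fst u) * chi (dot (snd u) g)"
  by (simp add: matrix_matrix_mult_def weyl_index if_distrib[of "\<lambda>x. _ * x"] sum.delta cong: if_cong)

lemma weyl_mult_index:
  "(weyl u ** (A :: complex^'a::finite^('q::finite \<Rightarrow> 'm::nontriv mod_ring))) $ f $ g
     = chi (dot (snd u) (f - fst u)) * A $ (f - fst u) $ g"
proof -
  have "f = h + fst u \<longleftrightarrow> h = f - fst u" for h by auto
  then show ?thesis
    by (simp add: matrix_matrix_mult_def weyl_index if_distrib[of "\<lambda>x. x * _"] sum.delta cong: if_cong)
qed

lemma weyl_mult: "weyl u ** weyl v = mat (chi (dot (snd u) (fst v))) ** weyl (u + v)"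
proof -
  have "(weyl u ** weyl v) $ f $ g = (mat (chi (dot (snd u) (fst v))) ** weyl (u + v)) $ f $ g" for f g
    by (subst mult_weyl_index) (simp add: weyl_index chi_add dot_add algebra_simps)
  then show ?thesis by (simp add: vec_eq_iff)
qed

lemma weyl_0 [simp]: "weyl 0 = mat 1"
  by (simp add: vec_eq_iff weyl_index mat_vec_index)

lemma weyl_mult_phase: "weyl u ** weyl v \<sim>\<^sub>p weyl (u + v)"
  by (simp add: weyl_mult phase_eq_mat)

lemma pauli_X_eq_weyl: "pauli_X j = weyl (single j 1, 0)"
  by (auto simp: pauli_X_def weyl_def vec_eq_iff single_def fun_eq_iff)

lemma pauli_Z_eq_weyl: "pauli_Z j = weyl (0, single j 1)"
  by (simp add: pauli_Z_def weyl_def vec_eq_iff chi_def)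

lemma dagger_weyl: "dagger (weyl u) = mat (chi (dot (snd u) (fst u))) ** weyl (- u)"
proof -
  have "f = g + a \<longleftrightarrow> g = f - a" for f g a :: "'a \<Rightarrow> 'b mod_ring" by auto
  then show ?thesis
    by (auto simp: vec_eq_iff weyl_index cnj_chi dot_diff dot_minus chi_add[symmetric])
qed

lemma unitary_weyl [simp]: "unitary (weyl u)"
proof (rule unitaryI)
  have "dagger (weyl u) ** weyl u
      = mat (chi (dot (snd u) (fst u)) * chi (dot (snd (- u)) (fst u))) ** weyl 0"
    by (simp add: dagger_weyl mat_mult_assoc weyl_mult mat_mult_mat_left del: weyl_0)
  then show "dagger (weyl u) ** weyl u = mat 1"
    by (simp add: dot_minus chi_minus)
qed

lemma dagger_weyl_phase: "dagger (weyl u) \<sim>\<^sub>p weyl (- u)"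
  by (simp add: dagger_weyl phase_eq_mat)

text \<open>The symplectic form on phase points: the exponent of the commutator of two Weyl
  operators.\<close>

definition sympl :: "('q::finite, 'm::nontriv) phase_point \<Rightarrow> ('q, 'm) phase_point \<Rightarrow> 'm mod_ring" where
  "sympl u v = dot (snd u) (fst v) - dot (snd v) (fst u)"

lemma sympl_add: "sympl (u + v) w = sympl u w + sympl v w" "sympl u (v + w) = sympl u v + sympl u w"
  by (simp_all add: sympl_def dot_add)

lemma sympl_diff: "sympl (u - v) w = sympl u w - sympl v w" "sympl u (v - w) = sympl u v - sympl u w"
  by (simp_all add: sympl_def dot_diff)

lemma sympl_0 [simp]: "sympl 0 u = 0" "sympl u 0 = 0"
  by (simp_all add: sympl_def)

lemma sympl_sum:
  "sympl (\<Sum>i\<in>I. f i) v = (\<Sum>i\<in>I. sympl (f i) v)" "sympl v (\<Sum>i\<in>I. f i) = (\<Sum>i\<in>I. sympl v (f i))"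
  by (induction I rule: infinite_finite_induct) (simp_all add: sympl_add)

lemma sympl_swap: "sympl v u = - sympl u v"
  by (simp add: sympl_def)

definition scale :: "'m::nontriv mod_ring \<Rightarrow> ('q, 'm) phase_point \<Rightarrow> ('q, 'm) phase_point" where
  "scale x u = (\<lambda>j. x * fst u j, \<lambda>j. x * snd u j)"

lemma dot_scale: "dot (\<lambda>j. x * f j) g = x * dot f g" "dot f (\<lambda>j. x * g j) = x * dot f g"
  by (simp_all add: dot_def sum_distrib_left mult_ac)

lemma sympl_scale [simp]: "sympl (scale x u) v = x * sympl u v" "sympl u (scale x v) = x * sympl u v"
  by (simp_all add: sympl_def scale_def dot_scale algebra_simps)

lemma scale_simps [simp]: "scale 0 u = 0" "scale 1 u = u"
  by (auto simp: scale_def prod_eq_iff fun_eq_iff)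

lemma scale_add: "scale (x + y) u = scale x u + scale y u"
  by (auto simp: scale_def prod_eq_iff fun_eq_iff algebra_simps)

lemma weyl_commute: "weyl u ** weyl v = mat (chi (sympl u v)) ** (weyl v ** weyl u)"
  by (simp add: weyl_mult mat_mult_mat_left chi_add[symmetric] sympl_def add.commute)

lemma group_comm_weyl: "group_comm (weyl u) (weyl v) = mat (chi (sympl u v))"
  using group_comm_eq_iff[THEN iffD2, OF unitary_weyl unitary_weyl weyl_commute] .

lemma weyl_commute_iff: "weyl u ** weyl v = weyl v ** weyl u \<longleftrightarrow> sympl u v = 0"
proof
  assume *: "weyl u ** weyl v = weyl v ** weyl u"
  have "mat 1 = group_comm (weyl u) (weyl v)"
    using group_comm_eq_iff[of "weyl u" "weyl v" 1] * by simp
  also have "\<dots> = mat (chi (sympl u v))"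
    by (rule group_comm_weyl)
  finally have "(mat 1 :: ('a, 'b) qop) $ undefined $ undefined
      = (mat (chi (sympl u v)) :: ('a, 'b) qop) $ undefined $ undefined"
    by (rule arg_cong)
  then show "sympl u v = 0" using chi_eq_1_iff[of "sympl u v"] by (simp add: mat_vec_index)
qed (subst weyl_commute, simp)

lemma phase_commute_iff:
  assumes "A \<sim>\<^sub>p weyl u" "B \<sim>\<^sub>p weyl v"
  shows "A ** B = mat (chi x) ** (B ** A) \<longleftrightarrow> sympl u v = x"
proof -
  have "A ** B = mat (chi x) ** (B ** A) \<longleftrightarrow> group_comm A B = mat (chi x)"
    using group_comm_eq_iff[of A B] assms by (simp add: phase_eq_unitary)
  also have "\<dots> \<longleftrightarrow> group_comm (weyl u) (weyl v) = mat (chi x)"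
    by (simp add: group_comm_phase[OF assms])
  also have "group_comm (weyl u) (weyl v) = mat (chi (sympl u v))"
    by (rule group_comm_weyl)
  also have "(mat (chi (sympl u v)) :: ('a, 'b) qop) = mat (chi x) \<longleftrightarrow> chi (sympl u v) = chi x"
    by (auto simp: vec_eq_iff mat_vec_index)
  finally show ?thesis by (simp add: chi_inj)
qed

lemma trace_mat_mult: "trace (mat c ** A) = c * trace (A :: complex^'a::finite^'a)"
  by (simp add: trace_def sum_distrib_left)

text \<open>A nonzero shift leaves no diagonal entries; with zero shift the diagonal sums to a
  character sum, which vanishes unless the character is trivial.\<close>

lemma trace_weyl: "trace (weyl (u :: ('q::finite, 'm::nontriv) phase_point))
    = (if u = 0 then of_nat CARD('q \<Rightarrow> 'm mod_ring) else 0)"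
proof (cases "fst u = 0")
  case True
  have tr: "trace (weyl u) = (\<Sum>g\<in>UNIV. chi (dot (snd u) g))"
    by (simp add: trace_def weyl_index True)
  have "trace (weyl u) = 0" if j: "snd u j \<noteq> 0" for j
    unfolding tr by (rule sum_chi_hom_eq_0[of _ "single j 1"]) (use j in \<open>simp_all add: dot_add\<close>)
  moreover have "u = 0 \<or> (\<exists>j. snd u j \<noteq> 0)" using True by (auto simp: prod_eq_iff fun_eq_iff)
  ultimately show ?thesis by (auto simp: trace_def mat_vec_index)
next
  case False
  then show ?thesis by (auto simp: trace_def weyl_index)
qed

text \<open>The Weyl operators form an orthogonal basis for the Hilbert-Schmidt inner product.\<close>

lemma weyl_expansion:
  fixes E :: "('q::finite, 'm::nontriv) qop"
  shows "E = (\<Sum>u\<in>UNIV. mat (trace (dagger (weyl u) ** E) / of_nat CARD('q \<Rightarrow> 'm mod_ring)) ** weyl u)"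
    (is "E = ?R")
proof -
  have tr: "trace (dagger (weyl (a, b)) ** E) = (\<Sum>g\<in>UNIV. E $ (g + a) $ g * chi (- dot b g))" for a b
  proof -
    have "trace (dagger (weyl (a, b)) ** E)
        = (\<Sum>g\<in>UNIV. \<Sum>h\<in>UNIV. if h = g + a then chi (- dot b g) * E $ h $ g else 0)"
      by (simp add: trace_def matrix_matrix_mult_def weyl_index cnj_chi
          if_distrib[of cnj] if_distrib[of "\<lambda>x. x * _"] cong: if_cong)
    then show ?thesis by (simp add: sum.delta mult.commute)
  qed
  \<comment> \<open>Character orthogonality: summing over all b singles out g = h, which collapses
    the double sum below to one entry of E.\<close>
  have orth: "(\<Sum>b\<in>UNIV. chi (dot b g - dot b h)) = (if g = h then of_nat CARD('q \<Rightarrow> 'm mod_ring) else 0)"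
    for g h :: "'q \<Rightarrow> 'm mod_ring"
  proof (cases "g = h")
    case False
    then obtain j where "g j \<noteq> h j" by auto
    then show ?thesis
      using sum_chi_hom_eq_0[of "\<lambda>b. dot b g - dot b h" "single j 1"] False by (simp add: dot_add)
  qed simp
  have "?R $ f $ g = E $ f $ g" for f g
  proof -
    let ?n = "of_nat CARD('q \<Rightarrow> 'm mod_ring) :: complex"
    have "?R $ f $ g = (\<Sum>a\<in>UNIV. \<Sum>b\<in>UNIV.
        (\<Sum>h\<in>UNIV. E $ (h + a) $ h * chi (- dot b h)) / ?n *
          (if f = g + a then chi (dot b g) else 0))"
      by (simp add: UNIV_Times_UNIV[symmetric] sum.cartesian_product tr weyl_index case_prod_unfold del: UNIV_Times_UNIV)
         (simp only: tr[symmetric] prod.collapse)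
    also have "\<dots> = (\<Sum>b\<in>UNIV. \<Sum>a\<in>UNIV. if a = f - g then
        (\<Sum>h\<in>UNIV. E $ (h + a) $ h * chi (- dot b h)) / ?n * chi (dot b g) else 0)"
      by (subst sum.swap) (intro sum.cong; auto)
    also have "\<dots> = (\<Sum>b\<in>UNIV. \<Sum>h\<in>UNIV. E $ (h + (f - g)) $ h * chi (dot b g - dot b h) / ?n)"
      by (simp add: sum.delta chi_diff chi_minus sum_distrib_left sum_divide_distrib mult_ac)
    also have "\<dots> = (\<Sum>h\<in>UNIV. E $ (h + (f - g)) $ h / ?n * (\<Sum>b\<in>UNIV. chi (dot b g - dot b h)))"
      by (subst sum.swap) (simp add: sum_distrib_left)
    also have "\<dots> = E $ f $ g"
      by (simp add: orth if_distrib[of "\<lambda>x. _ * x"] sum.delta cong: if_cong)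
    finally show ?thesis .
  qed
  then show ?thesis by (simp add: vec_eq_iff)
qed

text \<open>Conjugation by \<open>weyl v\<close> fixes E and multiplies \<open>weyl u\<close> by a
  value of \<open>chi\<close>. The coefficient is a trace, hence invariant under conjugation, so
  that value is 1 unless the coefficient vanishes.\<close>

lemma commute_weyl_coeff:
  assumes "E ** weyl v = weyl v ** E" "trace (dagger (weyl u) ** E) \<noteq> 0"
  shows "sympl u v = 0"
proof -
  have "dagger (weyl u) ** weyl v = mat (chi (- sympl u v)) ** (weyl v ** dagger (weyl u))"
  proof -
    have "sympl (- u) v = - sympl u v" using sympl_diff(1)[of 0 u v] by simp
    then show ?thesis using phase_commute_iff[OF dagger_weyl_phase phase_eq_refl] by blast
  qed
  moreover have "dagger (weyl u) ** E ** weyl v = (dagger (weyl u) ** weyl v) ** E"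
    by (simp only: matrix_mul_assoc[symmetric] assms(1))
  ultimately have "dagger (weyl u) ** E ** weyl v = mat (chi (- sympl u v)) ** (weyl v ** (dagger (weyl u) ** E))"
    by (simp only: mat_mult_assoc matrix_mul_assoc[symmetric])
  then have "trace (dagger (weyl u) ** E ** weyl v ** dagger (weyl v))
     = chi (- sympl u v) * trace (weyl v ** (dagger (weyl u) ** E) ** dagger (weyl v))"
    by (simp add: mat_mult_assoc trace_mat_mult)
  also have "trace (weyl v ** (dagger (weyl u) ** E) ** dagger (weyl v)) = trace (dagger (weyl u) ** E)"
    by (subst trace_mul_sym) (simp add: cancel_dagger)
  finally have "trace (dagger (weyl u) ** E) = chi (- sympl u v) * trace (dagger (weyl u) ** E)"
    by (simp add: cancel_dagger)
  then have "chi (- sympl u v) = 1" using assms(2) by simp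
  then show ?thesis by (simp add: chi_eq_1_iff)
qed

lemma add_matrix_mult: "(A + B) ** C = A ** C + B ** (C :: complex^'c::finite^'b::finite)"
  by (simp add: vec_eq_iff matrix_matrix_mult_def distrib_right sum.distrib)

lemma zero_matrix_mult [simp]:
  "0 ** (C :: complex^'c::finite^'b::finite) = 0" "(C :: complex^'c::finite^'b::finite) ** 0 = 0"
  by (simp_all add: vec_eq_iff matrix_matrix_mult_def)

lemma sum_mat_mult:
  "(\<Sum>i\<in>I. A i) ** B = (\<Sum>i\<in>I. A i ** (B :: complex^'c::finite^'b::finite))"
  "C ** (\<Sum>i\<in>I. A i) = (\<Sum>i\<in>I. C ** (A i :: complex^'b::finite^'a::finite))"
  by (induction I rule: infinite_finite_induct)
     (simp_all add: add_matrix_mult matrix_add_ldistrib)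

text \<open>Reduces an additive property of E to those Weyl operators that really occur in E, so
  that the commutation or locality of E can be used for each of them.\<close>

lemma weyl_expansion_induct:
  fixes E :: "('q::finite, 'm::nontriv) qop"
  assumes "P 0" "\<And>A B. P A \<Longrightarrow> P B \<Longrightarrow> P (A + B)"
    and "\<And>c u. trace (dagger (weyl u) ** E) \<noteq> 0 \<Longrightarrow> P (mat c ** weyl u)"
  shows "P E"
proof -
  have "P (\<Sum>u\<in>I. mat (trace (dagger (weyl u) ** E) / of_nat CARD('q \<Rightarrow> 'm mod_ring)) ** weyl u)"
    if "finite I" for I using that
  proof (induction I)
    case (insert u I)
    have "mat 0 ** weyl u = (0 :: ('q, 'm) qop)" by (simp add: vec_eq_iff)
    then have "P (mat (trace (dagger (weyl u) ** E) / of_nat CARD('q \<Rightarrow> 'm mod_ring)) ** weyl u)"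
      using assms(1) assms(3)[of u] by (cases "trace (dagger (weyl u) ** E) = 0") auto
    then show ?case using insert assms(2) by simp
  qed (use assms in simp)
  then have "P (\<Sum>u\<in>UNIV. mat (trace (dagger (weyl u) ** E) / of_nat CARD('q \<Rightarrow> 'm mod_ring)) ** weyl u)"
    by simp
  then show ?thesis by (subst weyl_expansion[of E])
qed

text \<open>Irreducibility of the Pauli operators: commuting with every X_j and Z_j kills all
  coordinates of a phase point that occurs in E, leaving only the identity.\<close>

lemma commute_all_weyl_scalar:
  assumes "\<And>j. E ** pauli_X j = pauli_X j ** (E :: ('q::finite, 'm::nontriv) qop)"
    "\<And>j. E ** pauli_Z j = pauli_Z j ** E"
  shows "\<exists>c. E = mat c"
proof (induction E rule: weyl_expansion_induct)
  case 1
  show ?case by (rule exI[of _ 0]) (auto simp: vec_eq_iff mat_vec_index)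
next
  case (2 A B)
  then obtain c d where "A = mat c" "B = mat d" by auto
  then show ?case by (intro exI[of _ "c + d"]) (auto simp: vec_eq_iff mat_vec_index)
next
  case (3 c u)
  have "fst u j = 0 \<and> snd u j = 0" for j
    using commute_weyl_coeff[OF assms(1)[of j, unfolded pauli_X_eq_weyl] 3]
      commute_weyl_coeff[OF assms(2)[of j, unfolded pauli_Z_eq_weyl] 3]
    by (simp add: sympl_def)
  then have "u = 0" by (auto simp: prod_eq_iff fun_eq_iff)
  then show ?case by auto
qed

subsection \<open>Locality\<close>

lemma commute_phase:
  "A \<sim>\<^sub>p B \<Longrightarrow> E ** B = B ** E \<Longrightarrow> E ** A = A ** (E :: complex^'a::finite^'a)"
  by (auto simp: phase_eq_def mult_mat_left mat_mult_assoc)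

lemma commute_mult:
  assumes "A ** W = W ** A" "B ** W = W ** (B :: complex^'a::finite^'a)"
  shows "(A ** B) ** W = W ** (A ** B)"
proof -
  have "(A ** B) ** W = A ** (W ** B)" by (simp only: matrix_mul_assoc[symmetric] assms)
  also have "\<dots> = W ** (A ** B)" by (simp only: matrix_mul_assoc assms)
  finally show ?thesis .
qed

text \<open>The operators on the tensor factor R are the commutant of the Paulis outside R. In this
  form closure under products, adjoints and phases is immediate, and locality can be tracked through
  conjugation.\<close>

lemma acts_only_on_iff:
  fixes E :: "('q::finite, 'm::nontriv) qop"
  shows "acts_only_on R E \<longleftrightarrow>
    (\<forall>u. (\<forall>j\<in>R. fst u j = 0 \<and> snd u j = 0) \<longrightarrow> E ** weyl u = weyl u ** E)"
    (is "_ \<longleftrightarrow> ?R")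
proof
  assume "acts_only_on R E"
  then obtain w where w: "\<And>f g. E $ f $ g =
      (if \<forall>j. j \<notin> R \<longrightarrow> f j = g j then w (restrict f R) (restrict g R) else 0)"
    unfolding acts_only_on_def by blast
  show ?R
  proof (intro allI impI)
    fix u :: "('q, 'm) phase_point" assume u: "\<forall>j\<in>R. fst u j = 0 \<and> snd u j = 0"
    have "E $ f $ (g + fst u) * chi (dot (snd u) g)
        = chi (dot (snd u) (f - fst u)) * E $ (f - fst u) $ g" for f g
    proof (cases "\<forall>j. j \<notin> R \<longrightarrow> f j = g j + fst u j")
      case True
      have "restrict f R = restrict (f - fst u) R" "restrict g R = restrict (g + fst u) R"
        using u by (auto simp: restrict_def fun_eq_iff)
      moreover have "dot (snd u) (f - fst u) = dot (snd u) g"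
        unfolding dot_def
      proof (rule sum.cong)
        show "snd u j * (f - fst u) j = snd u j * g j" for j
          using u True by (cases "j \<in> R") auto
      qed simp
      ultimately show ?thesis using True by (simp add: w)
    next
      case False
      then obtain j where "j \<notin> R" "f j \<noteq> g j + fst u j" by blast
      then have "\<not> (\<forall>j. j \<notin> R \<longrightarrow> f j = (g + fst u) j)" "\<not> (\<forall>j. j \<notin> R \<longrightarrow> (f - fst u) j = g j)"
        by (auto simp: diff_eq_eq)
      then show ?thesis by (simp only: w if_False) simp
    qed
    then show "E ** weyl u = weyl u ** E"
      by (simp add: vec_eq_iff mult_weyl_index weyl_mult_index)
  qed
next
  assume R: ?R
  \<comment> \<open>Commuting with Z_j makes E diagonal in coordinate j.\<close>
  have diag: "E $ f $ g = 0" if "j \<notin> R" "f j \<noteq> g j" for f g j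
  proof -
    have "E ** weyl (0, single j 1) = weyl (0, single j 1) ** E"
      by (rule R[rule_format]) (use that(1) in \<open>auto simp: single_def\<close>)
    then have "(E ** weyl (0, single j 1)) $ f $ g = (weyl (0, single j 1) ** E) $ f $ g" by simp
    then show ?thesis using that(2) by (auto simp: mult_weyl_index weyl_mult_index chi_inj)
  qed
  \<comment> \<open>Commuting with shifts off R makes the entries of E independent of the common
    coordinates there.\<close>
  have shift: "E $ (f + a) $ (g + a) = E $ f $ g" if "\<forall>j\<in>R. a j = 0" for f g a
  proof -
    have "E ** weyl (a, 0) = weyl (a, 0) ** E"
      by (rule R[rule_format]) (use that in auto)
    then have "(E ** weyl (a, 0)) $ (f + a) $ g = (weyl (a, 0) ** E) $ (f + a) $ g" by simp
    then show ?thesis by (auto simp: mult_weyl_index weyl_mult_index)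
  qed
  have "E $ f $ g = (if \<forall>j. j \<notin> R \<longrightarrow> f j = g j then E $ restrict f R $ restrict g R else 0)" for f g
  proof (cases "\<forall>j. j \<notin> R \<longrightarrow> f j = g j")
    case True
    \<comment> \<open>The labels agree off R, so one shift, which vanishes on R, carries both to
      their restrictions, whose entries off R are the default value
      \<open>undefined\<close>.\<close>
    have "E $ (f + (restrict f R - f)) $ (g + (restrict f R - f)) = E $ f $ g"
      by (rule shift) simp
    moreover have "f + (restrict f R - f) = restrict f R" "g + (restrict f R - f) = restrict g R"
      using True by (auto simp: fun_eq_iff restrict_def)
    ultimately show ?thesis using True by simp
  next
    case False
    then show ?thesis using diag by auto
  qed
  then show "acts_only_on R E"
    unfolding acts_only_on_def by (intro exI[of _ "\<lambda>f g. E $ f $ g"] allI)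
qed

lemma acts_only_on_commute_weyl:
  "acts_only_on R E \<Longrightarrow> (\<And>j. j \<in> R \<Longrightarrow> fst u j = 0 \<and> snd u j = 0) \<Longrightarrow> E ** weyl u = weyl u ** E"
  unfolding acts_only_on_iff by blast

lemma acts_only_on_coeff:
  assumes "acts_only_on R E" "trace (dagger (weyl u) ** E) \<noteq> 0" "j \<notin> R"
  shows "fst u j = 0" "snd u j = 0"
proof -
  have "E ** weyl (0, single j 1) = weyl (0, single j 1) ** E"
    "E ** weyl (single j 1, 0) = weyl (single j 1, 0) ** E"
    by (rule acts_only_on_commute_weyl[OF assms(1)]; use assms(3) in \<open>auto simp: single_def\<close>)+
  from this[THEN commute_weyl_coeff, OF assms(2)] show "fst u j = 0" "snd u j = 0"
    by (simp_all add: sympl_def)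
qed

lemma sympl_disjoint:
  assumes "\<And>j. (fst u j = 0 \<and> snd u j = 0) \<or> (fst v j = 0 \<and> snd v j = 0)"
  shows "sympl u v = 0"
proof -
  have "dot (snd u) (fst v) = 0" "dot (snd v) (fst u) = 0"
    unfolding dot_def using assms by (auto intro!: sum.neutral) (metis mult_zero_left mult_zero_right)+
  then show ?thesis by (simp add: sympl_def)
qed

lemma acts_only_on_weyl:
  assumes "\<And>j. j \<notin> R \<Longrightarrow> fst u j = 0 \<and> snd u j = 0"
  shows "acts_only_on R (weyl u)"
  unfolding acts_only_on_iff weyl_commute_iff
proof (intro allI impI sympl_disjoint)
  fix v and j assume "\<forall>j\<in>R. fst v j = 0 \<and> snd v j = 0"
  then show "(fst u j = 0 \<and> snd u j = 0) \<or> (fst v j = 0 \<and> snd v j = 0)"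
    using assms by blast
qed

lemma acts_only_on_mult: "acts_only_on R A \<Longrightarrow> acts_only_on R B \<Longrightarrow> acts_only_on R (A ** B)"
  unfolding acts_only_on_iff using commute_mult by blast

lemma acts_only_on_phase: "A \<sim>\<^sub>p B \<Longrightarrow> acts_only_on R B \<Longrightarrow> acts_only_on R A"
  unfolding acts_only_on_iff using commute_phase[of A B, symmetric] by auto

lemma acts_only_on_dagger:
  fixes A :: "('q::finite, 'm::nontriv) qop"
  assumes "acts_only_on R A"
  shows "acts_only_on R (dagger A)"
  unfolding acts_only_on_iff
proof (intro allI impI)
  fix u :: "('q, 'm) phase_point" assume "\<forall>j\<in>R. fst u j = 0 \<and> snd u j = 0"
  then have "A ** weyl (- u) = weyl (- u) ** A"
    using acts_only_on_commute_weyl[OF assms, of "- u"] by simp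
  then have "dagger A ** dagger (weyl (- u)) = dagger (weyl (- u)) ** dagger A"
    by (simp only: dagger_mult[symmetric])
  moreover have "weyl u \<sim>\<^sub>p dagger (weyl (- u))"
    using dagger_weyl_phase[of "- u"] by (simp add: phase_eq_sym)
  ultimately show "dagger A ** weyl u = weyl u ** dagger A"
    using commute_phase by blast
qed

text \<open>Each Weyl operator occurring in A is supported inside R, hence trivial on T, and so
  commutes with B.\<close>

lemma acts_only_on_disjoint_commute:
  assumes "acts_only_on R A" "acts_only_on T B" "R \<inter> T = {}"
  shows "A ** B = B ** A"
proof (induction A rule: weyl_expansion_induct)
  case (2 X Y)
  then show ?case by (simp add: add_matrix_mult matrix_add_ldistrib)
next
  case (3 c u)
  have "B ** weyl u = weyl u ** B"
    by (rule acts_only_on_commute_weyl[OF assms(2)]) (use acts_only_on_coeff[OF assms(1) 3] assms(3) in auto)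
  then show ?case by (simp add: mat_mult_assoc mult_mat_left)
qed simp

text \<open>Moves the conjugation from B to W. Locality is a commutant condition, so the locality of
  a conjugate can be tested on conjugated Weyl operators.\<close>

lemma conj_commute:
  assumes "unitary K" "B ** (dagger K ** W ** K) = (dagger K ** W ** K) ** (B :: complex^'a::finite^'a)"
  shows "(K ** B ** dagger K) ** W = W ** (K ** B ** dagger K)"
proof -
  have "(K ** B ** dagger K) ** W = K ** (B ** (dagger K ** W ** K)) ** dagger K"
    by (simp only: matrix_mul_assoc cancel_dagger[OF assms(1)])
  also have "\<dots> = K ** ((dagger K ** W ** K) ** B) ** dagger K"
    by (simp only: assms(2))
  also have "\<dots> = W ** (K ** B ** dagger K)"
    by (simp only: matrix_mul_assoc unitaryD[OF assms(1)] matrix_mul_lid)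
  finally show ?thesis .
qed

lemma conj_weyl_phase:
  assumes "A \<sim>\<^sub>p weyl u"
  shows "dagger A ** weyl v ** A \<sim>\<^sub>p weyl v"
proof -
  have "dagger A ** weyl v ** A \<sim>\<^sub>p weyl (- u) ** weyl v ** weyl u"
    using assms by (intro phase_eq_mult) (auto intro: phase_eq_trans[OF phase_eq_dagger dagger_weyl_phase])
  also have "\<dots> \<sim>\<^sub>p weyl (- u + v) ** weyl u"
    by (intro phase_eq_mult weyl_mult_phase) simp
  also have "\<dots> \<sim>\<^sub>p weyl (- u + v + u)" by (rule weyl_mult_phase)
  finally show ?thesis by simp
qed

text \<open>The group of unitaries whose conjugation action respects the tensor factors of the blocks
  contains both the transversal operators and the Pauli operators, hence also the iterated commutators
  of the former with the latter.\<close>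

definition block_preserving :: "(nat \<Rightarrow> 'n::finite set) \<Rightarrow> nat \<Rightarrow> ('n, 'm::nontriv) qop \<Rightarrow> bool" where
  "block_preserving Q N K \<longleftrightarrow> unitary K \<and>
     (\<forall>i\<in>{1..N}. \<forall>B. acts_only_on (Q i) B \<longrightarrow>
        acts_only_on (Q i) (K ** B ** dagger K) \<and> acts_only_on (Q i) (dagger K ** B ** K))"

lemma block_preserving_unitary: "block_preserving Q N K \<Longrightarrow> unitary K"
  by (simp add: block_preserving_def)

lemma block_preserving_dagger: "block_preserving Q N K \<Longrightarrow> block_preserving Q N (dagger K)"
  by (auto simp: block_preserving_def unitary_dagger)

lemma block_preserving_one: "block_preserving Q N (mat 1)"
  by (simp add: block_preserving_def)

lemma block_preserving_mult:
  assumes "block_preserving Q N K" "block_preserving Q N L"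
  shows "block_preserving Q N (K ** L)"
proof -
  have "(K ** L) ** B ** dagger (K ** L) = K ** (L ** B ** dagger L) ** dagger K"
    "dagger (K ** L) ** B ** (K ** L) = dagger L ** (dagger K ** B ** K) ** L" for B
    by (simp_all add: dagger_mult matrix_mul_assoc)
  then show ?thesis using assms by (simp add: block_preserving_def unitary_mult)
qed

lemma block_preserving_comm:
  "block_preserving Q N K \<Longrightarrow> block_preserving Q N L \<Longrightarrow> block_preserving Q N (group_comm K L)"
  unfolding group_comm_def by (intro block_preserving_mult block_preserving_dagger)

text \<open>Conjugation by a Pauli only rephases Weyl operators, so it preserves every commutant of
  a set of them, for any region and not just for blocks.\<close>

lemma block_preserving_phase_weyl:
  fixes A :: "('q::finite, 'm::nontriv) qop"
  assumes "A \<sim>\<^sub>p weyl u"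
  shows "block_preserving Q N A"
proof -
  have A: "unitary A" using assms by (rule phase_eq_unitary) simp
  have conj: "acts_only_on R (D ** B ** dagger D)"
    if D: "D \<sim>\<^sub>p weyl v" "unitary D" and B: "acts_only_on R B" for D :: "('q, 'm) qop" and v R B
    unfolding acts_only_on_iff
  proof (intro allI impI conj_commute[OF D(2)])
    fix w :: "('q, 'm) phase_point" assume "\<forall>j\<in>R. fst w j = 0 \<and> snd w j = 0"
    then have "B ** weyl w = weyl w ** B" by (intro acts_only_on_commute_weyl[OF B]) auto
    then show "B ** (dagger D ** weyl w ** D) = dagger D ** weyl w ** D ** B"
      by (rule commute_phase[OF conj_weyl_phase[OF D(1)]])
  qed
  have "dagger A \<sim>\<^sub>p weyl (- u)"
    using assms by (rule phase_eq_trans[OF phase_eq_dagger dagger_weyl_phase])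
  from conj[OF this unitary_dagger[OF A]] conj[OF assms A] A show ?thesis
    by (simp add: block_preserving_def)
qed

text \<open>On its own block A stays inside the algebra of that block; operators on another block
  commute with A and are fixed by the conjugation.\<close>

lemma block_preserving_block:
  fixes A :: "('q::finite, 'm::nontriv) qop"
  assumes "unitary A" "acts_only_on (Q j) A" "j \<in> {1..N}" "disjoint_family_on Q {1..N}"
  shows "block_preserving Q N A"
  unfolding block_preserving_def
proof (intro conjI ballI allI impI)
  fix i and B :: "('q, 'm) qop" assume i: "i \<in> {1..N}" and B: "acts_only_on (Q i) B"
  have "acts_only_on (Q i) (A ** B ** dagger A) \<and> acts_only_on (Q i) (dagger A ** B ** A)"
  proof (cases "i = j")
    case True
    then show ?thesis using assms(2) B by (auto intro!: acts_only_on_mult acts_only_on_dagger)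
  next
    case False
    then have "A ** B = B ** A"
      using assms i by (intro acts_only_on_disjoint_commute[OF assms(2) B]) (auto simp: disjoint_family_on_def)
    then have "A ** B ** dagger A = B" "dagger A ** B ** A = dagger A ** (A ** B)"
      by (simp_all only: cancel_dagger[OF assms(1)] matrix_mul_assoc[symmetric, of "dagger A"])
    then have "A ** B ** dagger A = B" "dagger A ** B ** A = B"
      by (simp_all only: cancel_dagger[OF assms(1)])
    then show ?thesis using B by simp
  qed
  then show "acts_only_on (Q i) (A ** B ** dagger A)" "acts_only_on (Q i) (dagger A ** B ** A)" by auto
qed fact

lemma transversal_block_preserving:
  assumes "transversal Q N U" "disjoint_family_on Q {1..N}"
  shows "block_preserving Q N U"
proof -
  obtain A where A: "\<And>i. i \<in> {1..N} \<Longrightarrow> unitary (A i) \<and> acts_only_on (Q i) (A i)"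
    and U: "U = op_prod A {1..N}"
    using assms(1) unfolding transversal_def by blast
  have "A i ** A j = A j ** A i" if "i \<in> {1..N}" "j \<in> {1..N}" for i j
  proof (cases "i = j")
    case False
    then show ?thesis using A that assms(2)
      by (intro acts_only_on_disjoint_commute[of "Q i" _ "Q j"]) (auto simp: disjoint_family_on_def)
  qed simp
  moreover have "block_preserving Q N (A i)" if "i \<in> {1..N}" for i
    using A[OF that] that assms(2) block_preserving_block by blast
  ultimately have "block_preserving Q N (op_prod A {1..N})"
    by (intro op_prod_induct[where P = "\<lambda>_. block_preserving Q N"])
       (blast intro: block_preserving_mult block_preserving_one)+
  then show ?thesis using U by simp
qed

section \<open>Supports of commutators and of Weyl components\<close>

lemma supp_phase: "A \<sim>\<^sub>p B \<Longrightarrow> supp Q N A = supp Q N B"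
  unfolding supp_def using acts_only_on_phase phase_eq_sym by blast

lemma supp_subset: "supp Q N A \<subseteq> {1..N}"
  by (auto simp: supp_def)

lemma finite_supp [simp]: "finite (supp Q N A)"
  by (rule finite_subset[OF supp_subset]) simp

text \<open>The commutator is bracketed in two ways. If K is trivial on block i, so is the Pauli
  conjugate \<open>a ** dagger K ** dagger a\<close>. If a is trivial there, so is
  \<open>K ** a ** dagger K\<close>, because K maps Weyl operators on the block to operators on the
  block.\<close>

lemma supp_comm:
  fixes K :: "('q::finite, 'm::nontriv) qop"
  assumes K: "block_preserving Q N K" and a: "a \<sim>\<^sub>p weyl u"
  shows "supp Q N (group_comm K a) \<subseteq> supp Q N K \<inter> supp Q N a"
proof -
  have aU: "unitary a" using a by (rule phase_eq_unitary) simp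
  have KU: "unitary K" using K by (rule block_preserving_unitary)
  have "acts_only_on (- Q i) (group_comm K a)"
    if i: "i \<in> {1..N}" and triv: "acts_only_on (- Q i) K \<or> acts_only_on (- Q i) a" for i
    unfolding acts_only_on_iff
  proof (intro allI impI)
    fix w :: "('q, 'm) phase_point" assume w: "\<forall>j\<in>- Q i. fst w j = 0 \<and> snd w j = 0"
    have comm: "B ** weyl w = weyl w ** B" if "acts_only_on (- Q i) B" for B
      using w by (intro acts_only_on_commute_weyl[OF that]) auto
    from triv show "group_comm K a ** weyl w = weyl w ** group_comm K a"
    proof
      assume K': "acts_only_on (- Q i) K"
      have "(a ** dagger K ** dagger a) ** weyl w = weyl w ** (a ** dagger K ** dagger a)"
        by (rule conj_commute[OF aU commute_phase[OF conj_weyl_phase[OF a]]])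
           (rule comm[OF acts_only_on_dagger[OF K']])
      then have "K ** (a ** dagger K ** dagger a) ** weyl w = weyl w ** (K ** (a ** dagger K ** dagger a))"
        by (rule commute_mult[OF comm[OF K']])
      then show ?thesis by (simp add: group_comm_def matrix_mul_assoc)
    next
      assume a': "acts_only_on (- Q i) a"
      have "acts_only_on (Q i) (weyl w)" by (rule acts_only_on_weyl) (use w in auto)
      then have "acts_only_on (Q i) (dagger K ** weyl w ** K)"
        using K i by (simp add: block_preserving_def)
      then have "(K ** a ** dagger K) ** weyl w = weyl w ** (K ** a ** dagger K)"
        by (intro conj_commute[OF KU] acts_only_on_disjoint_commute[OF a']) auto
      then have "(K ** a ** dagger K) ** dagger a ** weyl w = weyl w ** ((K ** a ** dagger K) ** dagger a)"
        by (rule commute_mult[OF _ comm[OF acts_only_on_dagger[OF a']]])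
      then show ?thesis by (simp add: group_comm_def matrix_mul_assoc)
    qed
  qed
  then show ?thesis by (auto simp: supp_def)
qed

text \<open>Expanding an operator never enlarges its support, so statements about operators of small
  support reduce to Paulis of small weight.\<close>

lemma supp_weyl_coeff:
  assumes "trace (dagger (weyl u) ** E) \<noteq> 0"
  shows "supp Q N (weyl u) \<subseteq> supp Q N E"
proof -
  have "acts_only_on (- Q i) (weyl u)" if "acts_only_on (- Q i) E" for i
    by (rule acts_only_on_weyl) (use acts_only_on_coeff[OF that assms] in auto)
  then show ?thesis by (auto simp: supp_def)
qed

subsection \<open>Pauli group\<close>

lemma pauli_gens_phase:
  fixes p :: "('q::finite, 'm::nontriv) qop"
  shows "p \<in> pauli_gens y \<Longrightarrow> \<exists>u. p \<sim>\<^sub>p weyl u"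
proof -
  have "mat \<i> ** weyl u ** weyl v \<sim>\<^sub>p weyl (u + v)" for u v :: "('q, 'm) phase_point"
  proof -
    have "mat \<i> ** weyl u ** weyl v \<sim>\<^sub>p weyl u ** weyl v"
      by (simp add: mat_mult_assoc phase_eq_mat)
    also have "\<dots> \<sim>\<^sub>p weyl (u + v)" by (rule weyl_mult_phase)
    finally show ?thesis .
  qed
  then have "mat \<i> ** pauli_X j ** pauli_Z j \<sim>\<^sub>p weyl ((single j 1, 0) + (0, single j 1) :: ('q, 'm) phase_point)" for j
    by (simp only: pauli_X_eq_weyl pauli_Z_eq_weyl)
  moreover have "pauli_X j \<sim>\<^sub>p weyl (single j 1, 0)" "pauli_Z j \<sim>\<^sub>p weyl (0, single j 1)" for j :: 'q
    by (simp_all add: pauli_X_eq_weyl pauli_Z_eq_weyl)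
  moreover assume "p \<in> pauli_gens y"
  then have "(\<exists>j. p = pauli_X j) \<or> (\<exists>j. p = pauli_Z j) \<or> (\<exists>j. p = mat \<i> ** pauli_X j ** pauli_Z j)"
    unfolding pauli_gens_def by (auto split: if_splits)
  ultimately show "\<exists>u. p \<sim>\<^sub>p weyl u" by blast
qed

lemma generate_phase:
  assumes "\<And>p. p \<in> H \<Longrightarrow> \<exists>u. p \<sim>\<^sub>p weyl u" "p \<in> generate unitary_group H"
  shows "\<exists>u. p \<sim>\<^sub>p weyl u"
  using assms(2)
proof (rule generate_unitary_induct)
  show "H \<subseteq> {U. unitary U}" using assms(1) phase_eq_unitary unitary_weyl by blast
  have "mat 1 \<sim>\<^sub>p weyl 0" by simp
  then show "\<exists>u. mat 1 \<sim>\<^sub>p weyl u" by blast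
  show "\<exists>u. dagger h \<sim>\<^sub>p weyl u" if "h \<in> H" for h
    using assms(1)[OF that] phase_eq_trans[OF phase_eq_dagger dagger_weyl_phase] by blast
  show "\<exists>u. a ** b \<sim>\<^sub>p weyl u" if "\<exists>u. a \<sim>\<^sub>p weyl u" "\<exists>u. b \<sim>\<^sub>p weyl u" for a b
    using that phase_eq_trans[OF phase_eq_mult weyl_mult_phase] by blast
qed (rule assms(1))

lemma pauli_group_phase: "p \<in> pauli_group y \<Longrightarrow> \<exists>u. p \<sim>\<^sub>p weyl u"
  unfolding pauli_group_def by (rule generate_phase[OF pauli_gens_phase])

lemma pauli_group_mult: "p \<in> pauli_group y \<Longrightarrow> q \<in> pauli_group y \<Longrightarrow> p ** q \<in> pauli_group y"
  unfolding pauli_group_def using generate.eng[of p unitary_group _ q] by simp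

lemma pauli_group_one: "mat 1 \<in> pauli_group y"
  unfolding pauli_group_def using generate.one[of unitary_group] by simp

text \<open>The additive group of Z_m is generated by 1, so closure under sums already gives all
  multiples of the unit vectors.\<close>

lemma additive_span_single:
  fixes P :: "('q::finite \<Rightarrow> 'm::nontriv mod_ring) \<Rightarrow> bool"
  assumes "P 0" "\<And>a b. P a \<Longrightarrow> P b \<Longrightarrow> P (a + b)" "\<And>j. P (single j 1)"
  shows "P a"
proof -
  have s: "P (single j x)" for j x
  proof -
    have "P (single j (of_nat t))" for t
    proof (induction t)
      case 0
      have "single j (of_nat 0) = (0 :: 'q \<Rightarrow> 'm mod_ring)" by (auto simp: single_def fun_eq_iff)
      then show ?case using assms(1) by (simp only:)
    next
      case (Suc t)
      have "single j (of_nat (Suc t)) = single j 1 + (single j (of_nat t) :: 'q \<Rightarrow> 'm mod_ring)"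
        by (auto simp: single_def fun_eq_iff)
      then show ?case using assms(2)[OF assms(3) Suc] by (simp only:)
    qed
    from this[of "nat_of x"] show ?thesis by simp
  qed
  have "P (\<Sum>j\<in>I. single j (a j))" if "finite I" for I
    using that
  proof induction
    case empty
    show ?case by (simp only: sum.empty assms(1))
  next
    case (insert j I)
    then show ?case unfolding sum.insert[OF insert.hyps] by (intro assms(2) s)
  qed
  moreover have "(\<Sum>j\<in>UNIV. single j (a j)) = a"
  proof
    fix i
    have "(\<Sum>j\<in>I. single j (a j)) i = (\<Sum>j\<in>I. single j (a j) i)" for I
      by (induction I rule: infinite_finite_induct) auto
    then show "(\<Sum>j\<in>UNIV. single j (a j)) i = a i"
      by (simp add: single_def sum.delta')
  qed
  ultimately show ?thesis using finite[of "UNIV :: 'q set"] by metis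
qed

text \<open>Membership is exact, with no extra phase: pure shifts multiply without a phase, so do
  pure Z powers, and X^a before Z^b is the ordering built into \<open>weyl\<close>.\<close>

lemma weyl_in_pauli_group: "weyl u \<in> pauli_group y"
proof -
  have gen: "pauli_X j \<in> pauli_group y" "pauli_Z j \<in> pauli_group y" for j
    unfolding pauli_group_def by (auto intro!: generate.incl simp: pauli_gens_def)
  have "weyl (a, 0) \<in> pauli_group y" for a
  proof (rule additive_span_single[where P = "\<lambda>a. weyl (a, 0) \<in> pauli_group y"])
    show "weyl (0, 0) \<in> pauli_group y" using pauli_group_one by (simp add: zero_prod_def[symmetric])
    show "weyl (a + b, 0) \<in> pauli_group y" if "weyl (a, 0) \<in> pauli_group y" "weyl (b, 0) \<in> pauli_group y" for a b
      using pauli_group_mult[OF that] by (simp add: weyl_mult)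
    show "weyl (single j 1, 0) \<in> pauli_group y" for j
      using gen(1) by (simp add: pauli_X_eq_weyl)
  qed
  moreover have "weyl (0, b) \<in> pauli_group y" for b
  proof (rule additive_span_single[where P = "\<lambda>b. weyl (0, b) \<in> pauli_group y"])
    show "weyl (0, 0) \<in> pauli_group y" using pauli_group_one by (simp add: zero_prod_def[symmetric])
    show "weyl (0, a + b) \<in> pauli_group y" if "weyl (0, a) \<in> pauli_group y" "weyl (0, b) \<in> pauli_group y" for a b
      using pauli_group_mult[OF that] by (simp add: weyl_mult)
    show "weyl (0, single j 1) \<in> pauli_group y" for j
      using gen(2) by (simp add: pauli_Z_eq_weyl)
  qed
  ultimately have "weyl (fst u, 0) ** weyl (0, snd u) \<in> pauli_group y"
    by (rule pauli_group_mult)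
  then show ?thesis by (simp add: weyl_mult)
qed

text \<open>Conjugation by p multiplies D by c but leaves its trace unchanged.\<close>

lemma phase_commute_trace:
  assumes "unitary p" "D ** p = mat c ** (p ** (D :: complex^'a::finite^'a))" "trace D \<noteq> 0"
  shows "c = 1"
proof -
  have "trace D = trace (D ** p ** dagger p)" by (simp add: cancel_dagger assms(1))
  also have "\<dots> = c * trace (p ** D ** dagger p)" by (simp add: assms(2) mat_mult_assoc trace_mat_mult)
  also have "trace (p ** D ** dagger p) = trace D"
    by (subst trace_mul_sym) (simp add: cancel_dagger assms(1))
  finally show ?thesis using assms(3) by simp
qed

text \<open>Strip from B a Weyl operator that occurs in it. The quotient D commutes with every Weyl
  operator up to a scalar, and its nonzero trace forces that scalar to be 1, so D is itself a
  scalar.\<close>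

lemma clifford_level_1I:
  fixes B :: "('q::finite, 'm::nontriv) qop"
  assumes "unitary B" "\<And>p. p \<in> pauli_group y \<Longrightarrow> \<exists>c. group_comm B p = mat c"
  shows "B \<in> clifford_level y (Suc 0)"
proof -
  have "\<exists>u. trace (dagger (weyl u) ** B) \<noteq> 0"
  proof (rule ccontr)
    assume *: "\<not> ?thesis"
    have "B = 0"
    proof (induction B rule: weyl_expansion_induct)
      case (3 c u)
      then show ?case using * by blast
    qed auto
    then have "(mat 1 :: ('q, 'm) qop) $ undefined $ undefined = 0" using unitaryD(1)[OF assms(1)] by simp
    then show False by (simp add: mat_vec_index)
  qed
  then obtain u where u: "trace (dagger (weyl u) ** B) \<noteq> 0" by blast
  define D where "D = dagger (weyl u) ** B"
  have D: "unitary D" unfolding D_def by (intro unitary_mult unitary_dagger assms(1) unitary_weyl)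
  have comm: "D ** weyl v = weyl v ** D" for v
  proof -
    obtain c where "group_comm B (weyl v) = mat c" using assms(2) weyl_in_pauli_group by blast
    then have c: "B ** weyl v = mat c ** (weyl v ** B)"
      using group_comm_eq_iff[OF assms(1) unitary_weyl] by blast
    obtain d where d: "dagger (weyl u) ** weyl v = mat d ** (weyl v ** dagger (weyl u))"
      using phase_commute_iff[OF dagger_weyl_phase[of u] phase_eq_refl[of "weyl v"]] by blast
    have "D ** weyl v = dagger (weyl u) ** (mat c ** (weyl v ** B))"
      by (simp only: D_def c matrix_mul_assoc[symmetric])
    also have "\<dots> = mat c ** ((dagger (weyl u) ** weyl v) ** B)"
      by (simp only: mult_mat_left matrix_mul_assoc[symmetric])
    also have "\<dots> = mat (c * d) ** (weyl v ** D)"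
      by (simp only: d D_def mat_mult_assoc mat_mult_mat_left matrix_mul_assoc[of "weyl v", symmetric])
    finally have e: "D ** weyl v = mat (c * d) ** (weyl v ** D)" .
    then have "c * d = 1" using phase_commute_trace[of "weyl v" D] u by (simp add: D_def)
    with e show ?thesis by simp
  qed
  obtain c where c: "D = mat c"
    using commute_all_weyl_scalar[of D] comm by (auto simp: pauli_X_eq_weyl pauli_Z_eq_weyl)
  have "B = weyl u ** D" by (simp add: D_def cancel_dagger)
  then have "B = mat c ** weyl u" by (simp add: c mat_central)
  moreover have "cmod c = 1" using D c by (simp add: unitary_norm_eq_1)
  ultimately show ?thesis
    unfolding clifford_level.simps using weyl_in_pauli_group[of u y] by blast
qed

text \<open>Serves the trivial logical Pauli, whose commutator with anything is the
  identity.\<close>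

lemma clifford_level_one: "mat 1 \<in> clifford_level y (Suc M)"
proof (induction M)
  case 0
  show ?case
    unfolding clifford_level.simps
    by (rule CollectI, rule exI[of _ 1], rule exI[of _ "mat 1"]) (simp add: pauli_group_one)
next
  case (Suc M)
  have "group_comm (mat 1) p = mat 1" if "p \<in> pauli_group y" for p :: "('a, 'b) qop"
  proof -
    have "unitary p" using that pauli_group_phase phase_eq_unitary unitary_weyl by blast
    then show ?thesis by (simp add: group_comm_def unitaryD)
  qed
  then show ?case using Suc by simp
qed

lemma pow_phase:
  assumes "A \<sim>\<^sub>p weyl u"
  shows "A [^]\<^bsub>unitary_group\<^esub> (t :: nat) \<sim>\<^sub>p weyl (scale (of_nat t) u)"
proof (induction t)
  case (Suc t)
  have "A [^]\<^bsub>unitary_group\<^esub> Suc t \<sim>\<^sub>p weyl (scale (of_nat t) u) ** weyl u"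
    using phase_eq_mult[OF Suc assms] by simp
  also have "\<dots> \<sim>\<^sub>p weyl (scale (of_nat t) u + u)" by (rule weyl_mult_phase)
  finally show ?case using scale_add[of "of_nat t" 1 u] by (simp add: add.commute)
qed simp

lemma phase_commute:
  "A \<sim>\<^sub>p weyl u \<Longrightarrow> B \<sim>\<^sub>p weyl v \<Longrightarrow> sympl u v = 0 \<Longrightarrow> A ** B = B ** A"
  using phase_commute_iff[of A u B v 0] by simp

lemma op_prod_phase:
  assumes "finite I" "\<And>i. A i \<sim>\<^sub>p weyl (w i)" "\<And>i j. i \<noteq> j \<Longrightarrow> sympl (w i) (w j) = 0"
  shows "op_prod A I \<sim>\<^sub>p weyl (\<Sum>i\<in>I. w i)"
proof (rule op_prod_induct[where P = "\<lambda>J B. B \<sim>\<^sub>p weyl (\<Sum>i\<in>J. w i)"])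
  show "A i ** A j = A j ** A i" for i j
    by (cases "i = j") (simp_all add: phase_commute[OF assms(2) assms(2) assms(3)])
  fix k J B assume J: "finite J" "k \<notin> J" and B: "B \<sim>\<^sub>p weyl (\<Sum>i\<in>J. w i)"
  have "A k ** B \<sim>\<^sub>p weyl (w k) ** weyl (\<Sum>i\<in>J. w i)"
    by (rule phase_eq_mult[OF assms(2) B])
  also have "\<dots> \<sim>\<^sub>p weyl (\<Sum>i\<in>insert k J. w i)"
    unfolding sum.insert[OF J] by (rule weyl_mult_phase)
  finally show "A k ** B \<sim>\<^sub>p weyl (\<Sum>i\<in>insert k J. w i)" .
qed (simp_all add: assms(1))

subsection \<open>Codes and their logical operators\<close>

locale stabilizer_code_with_logicals =
  fixes y :: bool
    and S :: "('n::finite, 'm::nontriv) qop set"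
    and Xb Zb :: "'k::finite \<Rightarrow> ('n, 'm) qop"
  assumes code: "stabilizer_code y S CARD('k)"
    and gens: "logical_generators y S Xb Zb"
begin

lemma S_subgroup: "subgroup S unitary_group"
  and S_phase: "s \<in> S \<Longrightarrow> \<exists>u. s \<sim>\<^sub>p weyl u"
proof -
  obtain H where H: "H \<subseteq> pauli_group y" "S = generate unitary_group H"
    using code by (auto simp: stabilizer_code_def)
  have "H \<subseteq> {U. unitary U}"
    using H(1) pauli_group_phase phase_eq_unitary unitary_weyl by blast
  then show "subgroup S unitary_group"
    using group.generate_is_subgroup[OF group_unitary_group, of H] H(2) by simp
  assume "s \<in> S"
  then have s: "s \<in> generate unitary_group H" using H(2) by simp
  show "\<exists>u. s \<sim>\<^sub>p weyl u"
  proof (rule generate_phase[OF _ s])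
    show "\<exists>u. p \<sim>\<^sub>p weyl u" if "p \<in> H" for p
      by (rule pauli_group_phase[OF subsetD[OF H(1) that]])
  qed
qed

lemma S_one: "mat 1 \<in> S"
  using subgroup.one_closed[OF S_subgroup] by simp

lemma S_unitary: "s \<in> S \<Longrightarrow> unitary s"
  using subgroup.mem_carrier[OF S_subgroup] by simp

lemma S_mult: "s \<in> S \<Longrightarrow> t \<in> S \<Longrightarrow> s ** t \<in> S"
  using subgroup.m_closed[OF S_subgroup] by simp

lemma S_dagger: "s \<in> S \<Longrightarrow> dagger s \<in> S"
  using subgroup.m_inv_closed[OF S_subgroup, of s] S_unitary by (simp add: inv_unitary_group)

lemma S_finite: "finite S"
  using code card_gt_0_iff[of S] by (simp add: stabilizer_code_def)

lemma code_space_nonzero: "\<exists>v \<in> code_space S. v \<noteq> 0"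
proof (rule ccontr)
  assume "\<not> ?thesis"
  then have "vec.dim (code_space S) = 0"
    by (subst vec.dim_eq_0) auto
  moreover have "vec.dim (code_space S) = CARD('m) ^ CARD('k)"
    using code by (simp add: stabilizer_code_def)
  ultimately have "CARD('m) ^ CARD('k) = 0" by (simp only:)
  then show False by simp
qed

definition xp :: "'k \<Rightarrow> ('n, 'm) phase_point" where "xp i = (SOME u. Xb i \<sim>\<^sub>p weyl u)"
definition zp :: "'k \<Rightarrow> ('n, 'm) phase_point" where "zp i = (SOME u. Zb i \<sim>\<^sub>p weyl u)"

lemma Xb_phase: "Xb i \<sim>\<^sub>p weyl (xp i)" and Zb_phase: "Zb i \<sim>\<^sub>p weyl (zp i)"
proof -
  have "Xb i \<in> pauli_group y" "Zb i \<in> pauli_group y"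
    using gens by (auto simp: logical_generators_def)
  then show "Xb i \<sim>\<^sub>p weyl (xp i)" "Zb i \<sim>\<^sub>p weyl (zp i)"
    unfolding xp_def zp_def by (auto intro: someI_ex pauli_group_phase)
qed

lemma Xb_unitary: "unitary (Xb i)" and Zb_unitary: "unitary (Zb i)"
  by (rule phase_eq_unitary[OF Xb_phase unitary_weyl] phase_eq_unitary[OF Zb_phase unitary_weyl])+

lemma S_commute: "s \<in> S \<Longrightarrow> Xb i ** s = s ** Xb i" "s \<in> S \<Longrightarrow> Zb i ** s = s ** Zb i"
  using gens by (auto simp: logical_generators_def)

text \<open>The logical generators pair exactly like single-qudit X and Z; the sign comes from the
  convention that X_i and Z_i have commutator omega^(-1).\<close>

lemma sympl_logical:
  "sympl (xp i) (zp j) = (if i = j then - 1 else 0)"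
  "sympl (zp i) (xp j) = (if i = j then 1 else 0)"
  "sympl (xp i) (xp j) = 0" "sympl (zp i) (zp j) = 0"
proof -
  have inj: "mat (chi x) = (mat (chi x') :: ('n, 'm) qop) \<Longrightarrow> x = x'" for x x' :: "'m mod_ring"
    by (auto simp: vec_eq_iff mat_vec_index chi_inj split: if_splits)
  have "mat (chi (sympl (xp i) (zp j))) = group_comm (Xb i) (Zb j)" for i j
    by (simp add: group_comm_phase[OF Xb_phase Zb_phase] group_comm_weyl)
  also have "\<dots> i j = mat (chi (if i = j then - 1 else 0 :: 'm mod_ring))" for i j
    using gens by (simp add: logical_generators_def chi_minus chi_1)
  finally have 1: "sympl (xp i) (zp j) = (if i = j then - 1 else 0)" for i j by (rule inj)
  from 1 show "sympl (xp i) (zp j) = (if i = j then - 1 else 0)" .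
  from 1 show "sympl (zp i) (xp j) = (if i = j then 1 else 0)"
    using sympl_swap[of "zp i" "xp j"] by auto
  have "mat (chi (sympl (xp i) (xp j))) = group_comm (Xb i) (Xb j)"
    by (simp add: group_comm_phase[OF Xb_phase Xb_phase] group_comm_weyl)
  also have "\<dots> = mat (chi (0 :: 'm mod_ring))"
    using gens by (simp add: logical_generators_def)
  finally show "sympl (xp i) (xp j) = 0" by (rule inj)
  have "mat (chi (sympl (zp i) (zp j))) = group_comm (Zb i) (Zb j)"
    by (simp add: group_comm_phase[OF Zb_phase Zb_phase] group_comm_weyl)
  also have "\<dots> = mat (chi (0 :: 'm mod_ring))"
    using gens by (simp add: logical_generators_def)
  finally show "sympl (zp i) (zp j) = 0" by (rule inj)
qed

text \<open>Sends a phase point of the k logical qudits to one of a physical Pauli that implements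
  it.\<close>

definition lift :: "('k, 'm) phase_point \<Rightarrow> ('n, 'm) phase_point" where
  "lift u = (\<Sum>i\<in>UNIV. scale (fst u i) (xp i) + scale (snd u i) (zp i))"

text \<open>Pairing with the generators recovers the coordinates of u; \<open>centralizer\<close>
  solves for u this way.\<close>

lemma sympl_lift: "sympl (lift u) (xp j) = snd u j" "sympl (lift u) (zp j) = - fst u j"
  by (simp_all add: lift_def sympl_sum sympl_add sympl_logical if_distrib[of "\<lambda>x. _ * x"] sum.delta sum.delta'
      cong: if_cong)

definition logical :: "('k, 'm) phase_point \<Rightarrow> ('n, 'm) qop" where
  "logical u = logical_pauli Xb Zb (\<lambda>i. nat_of (fst u i)) (\<lambda>i. nat_of (snd u i))"

definition factor :: "('k, 'm) phase_point \<Rightarrow> 'k \<Rightarrow> ('n, 'm) qop" where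
  "factor u i = (Xb i [^]\<^bsub>unitary_group\<^esub> nat_of (fst u i)) ** (Zb i [^]\<^bsub>unitary_group\<^esub> nat_of (snd u i))"

lemma logical_eq: "logical u = op_prod (factor u) UNIV"
  by (simp add: logical_def logical_pauli_def factor_def[abs_def])

lemma factor_phase: "factor u i \<sim>\<^sub>p weyl (scale (fst u i) (xp i) + scale (snd u i) (zp i))"
proof -
  have "factor u i \<sim>\<^sub>p weyl (scale (fst u i) (xp i)) ** weyl (scale (snd u i) (zp i))"
    unfolding factor_def
    using pow_phase[OF Xb_phase[of i], of "nat_of (fst u i)"] pow_phase[OF Zb_phase[of i], of "nat_of (snd u i)"]
    by (simp add: phase_eq_mult)
  also have "\<dots> \<sim>\<^sub>p weyl (scale (fst u i) (xp i) + scale (snd u i) (zp i))"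
    by (rule weyl_mult_phase)
  finally show ?thesis .
qed

lemma factor_commute: "factor u i ** factor u j = factor u j ** factor u i"
  by (cases "i = j") (simp_all add: phase_commute[OF factor_phase factor_phase] sympl_add sympl_logical)

lemma logical_phase: "logical u \<sim>\<^sub>p weyl (lift u)"
  unfolding logical_eq lift_def
  by (rule op_prod_phase[OF _ factor_phase]) (simp_all add: sympl_add sympl_logical)

definition coset :: "('k, 'm) phase_point \<Rightarrow> ('n, 'm) qop set" where
  "coset u = S #>\<^bsub>unitary_group\<^esub> logical u"

lemma coset_eq: "coset u = (\<lambda>s. s ** logical u) ` S"
  by (auto simp: coset_def r_coset_def)

text \<open>Exponents below m are residues in Z_m. Indexing the classes by nonzero phase points lets
  later proofs simply split on u = 0.\<close>

lemma nontrivial_logical_paulis_eq: "nontrivial_logical_paulis S Xb Zb = coset ` (- {0})"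
proof (intro equalityI subsetI)
  fix G assume "G \<in> nontrivial_logical_paulis S Xb Zb"
  then have "\<exists>a b. G = S #>\<^bsub>unitary_group\<^esub> logical_pauli Xb Zb a b \<and>
      (\<forall>i. a i < CARD('m) \<and> b i < CARD('m)) \<and> (\<exists>i. a i \<noteq> 0 \<or> b i \<noteq> 0)"
    by (simp only: nontrivial_logical_paulis_def mem_Collect_eq)
  then obtain a b where G: "G = S #>\<^bsub>unitary_group\<^esub> logical_pauli Xb Zb a b"
    and ab_bounds: "\<forall>i. a i < CARD('m) \<and> b i < CARD('m)" and ab_nonzero: "\<exists>i. a i \<noteq> 0 \<or> b i \<noteq> 0"
    by (elim exE, elim conjE) (rule that)
  have ab: "a i < CARD('m)" "b i < CARD('m)" for i using ab_bounds by simp_all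
  let ?u = "(\<lambda>i. of_nat (a i), \<lambda>i. of_nat (b i)) :: ('k, 'm) phase_point"
  have "G = coset ?u" using G ab by (simp add: coset_def logical_def nat_of_of_nat)
  moreover have "?u \<noteq> 0"
  proof
    assume "?u = 0"
    then have 0: "of_nat (a i) = (0 :: 'm mod_ring)" "of_nat (b i) = (0 :: 'm mod_ring)" for i
      by (simp_all add: prod_eq_iff fun_eq_iff)
    have "a i = 0" "b i = 0" for i
      using nat_of_of_nat[OF ab(1)[of i]] nat_of_of_nat[OF ab(2)[of i]]
      by (simp_all add: 0 nat_of_eq_0_iff[THEN iffD2])
    then show False using ab_nonzero by simp
  qed
  ultimately show "G \<in> coset ` (- {0})" by blast
next
  fix G assume "G \<in> coset ` (- {0})"
  then obtain u where u: "u \<noteq> 0" "G = coset u" by blast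
  have "\<exists>i. nat_of (fst u i) \<noteq> 0 \<or> nat_of (snd u i) \<noteq> 0"
    using u(1) by (auto simp: prod_eq_iff fun_eq_iff)
  then show "G \<in> nontrivial_logical_paulis S Xb Zb"
    unfolding nontrivial_logical_paulis_def u(2) coset_def logical_def
    by (intro CollectI exI[of _ "\<lambda>i. nat_of (fst u i)"] exI[of _ "\<lambda>i. nat_of (snd u i)"])
       (simp add: nat_of_less)
qed

lemma coset_phase:
  assumes "g \<in> coset u"
  shows "\<exists>v. g \<sim>\<^sub>p weyl v"
proof -
  obtain s where s: "s \<in> S" "g = s ** logical u" using assms by (auto simp: coset_eq)
  obtain t where "s \<sim>\<^sub>p weyl t" using S_phase s by blast
  then have "s ** logical u \<sim>\<^sub>p weyl (t + lift u)"
    by (intro phase_eq_trans[OF phase_eq_mult weyl_mult_phase] logical_phase)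
  then show ?thesis using s by blast
qed

lemma code_spaceD: "v \<in> code_space S \<Longrightarrow> s \<in> S \<Longrightarrow> s *v v = v"
  by (simp add: code_space_def)

lemma commute_code_space:
  assumes "\<And>s. s \<in> S \<Longrightarrow> A ** s = s ** A" "v \<in> code_space S"
  shows "A *v v \<in> code_space S"
proof -
  have "s *v (A *v v) = A *v v" if "s \<in> S" for s
    using assms(1)[OF that, symmetric] code_spaceD[OF assms(2) that]
    by (metis matrix_vector_mul_assoc)
  then show ?thesis by (simp add: code_space_def)
qed

section \<open>Compression to k qudits along a fixed identification\<close>

context
  fixes V :: "complex ^ ('k \<Rightarrow> 'm mod_ring) ^ ('n \<Rightarrow> 'm mod_ring)"
  assumes V: "code_identification S Xb Zb V"
begin

lemma V_isometry: "dagger V ** V = mat 1"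
  using V by (simp add: code_identification_def)

lemma V_range: "range ((*v) V) = code_space S"
  using V by (simp add: code_identification_def)

lemma V_stabilized: "s \<in> S \<Longrightarrow> s ** V = V"
proof -
  assume s: "s \<in> S"
  have "(s ** V) *v x = V *v x" for x
    using code_spaceD[OF _ s, of "V *v x"] V_range by (auto simp: matrix_vector_mul_assoc[symmetric])
  then show ?thesis by (simp add: matrix_eq)
qed

text \<open>\<open>V ** dagger V\<close> is the identity on the range of V, and A maps that range
  into itself.\<close>

lemma V_compress:
  assumes "\<And>v. v \<in> code_space S \<Longrightarrow> A *v v \<in> code_space S"
  shows "A ** V = V ** (dagger V ** A ** V)"
proof -
  have "(A ** V) *v x = (V ** (dagger V ** A ** V)) *v x" for x
  proof -
    have "A *v (V *v x) \<in> range ((*v) V)" using assms V_range by auto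
    then obtain w where w: "A *v (V *v x) = V *v w" by blast
    have "(V ** (dagger V ** A ** V)) *v x = V *v (dagger V *v (A *v (V *v x)))"
      by (simp only: matrix_vector_mul_assoc matrix_mul_assoc)
    also have "\<dots> = V *v (dagger V *v (V *v w))" by (simp only: w)
    also have "\<dots> = V *v w" by (simp add: matrix_vector_mul_assoc V_isometry)
    finally show ?thesis using w by (simp add: matrix_vector_mul_assoc)
  qed
  then show ?thesis by (simp add: matrix_eq)
qed

lemma V_cancel: "V ** A = V ** B \<Longrightarrow> A = (B :: complex^'c::finite^_)"
proof -
  assume "V ** A = V ** B"
  then have "dagger V ** V ** A = dagger V ** V ** B" by (simp only: matrix_mul_assoc[symmetric])
  then show ?thesis by (simp add: V_isometry)
qed

text \<open>A phase is allowed because an identification matches the generators only up to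
  phase.\<close>

definition represents :: "('n, 'm) qop \<Rightarrow> ('k, 'm) qop \<Rightarrow> bool" where
  "represents A B \<longleftrightarrow> A ** V \<sim>\<^sub>p V ** B"

lemma represents_mult:
  assumes "represents A B" "represents A' B'"
  shows "represents (A ** A') (B ** B')"
proof -
  have "A ** A' ** V \<sim>\<^sub>p A ** (V ** B')"
    using phase_eq_mult[OF phase_eq_refl assms(2)[unfolded represents_def], of A]
    by (simp add: matrix_mul_assoc)
  also have "A ** (V ** B') \<sim>\<^sub>p V ** B ** B'"
    using phase_eq_mult[OF assms(1)[unfolded represents_def] phase_eq_refl, of B']
    by (simp add: matrix_mul_assoc)
  finally show ?thesis by (simp add: represents_def matrix_mul_assoc)
qed

lemma represents_phase:
  assumes "represents A B" "B \<sim>\<^sub>p B'"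
  shows "represents A B'"
  using assms phase_eq_trans[OF _ phase_eq_mult[OF phase_eq_refl assms(2)]] by (auto simp: represents_def)

lemma represents_one: "represents (mat 1) (mat 1)"
  by (simp add: represents_def)

lemma represents_S: "s \<in> S \<Longrightarrow> represents s (mat 1)"
  by (simp add: represents_def V_stabilized)

lemma represents_X: "represents (Xb i) (pauli_X i)" and represents_Z: "represents (Zb i) (pauli_Z i)"
  using V by (auto simp: code_identification_def represents_def phase_eq_def matrix_mul_assoc)

lemma represents_pow:
  "represents A B \<Longrightarrow> represents (A [^]\<^bsub>unitary_group\<^esub> (t :: nat)) (B [^]\<^bsub>unitary_group\<^esub> t)"
  by (induction t) (simp_all add: represents_one represents_mult)

lemma represents_factor: "represents (factor u i) (weyl (single i (fst u i), single i (snd u i)))"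
proof -
  have "represents (factor u i) (pauli_X i [^]\<^bsub>unitary_group\<^esub> nat_of (fst u i) ** pauli_Z i [^]\<^bsub>unitary_group\<^esub> nat_of (snd u i))"
    unfolding factor_def by (intro represents_mult represents_pow represents_X represents_Z)
  moreover have "scale x (single i 1, 0) = (single i x, 0)" "scale x (0, single i 1) = (0, single i x)"
    for x :: "'m mod_ring" and i :: 'k
    by (auto simp: scale_def single_def fun_eq_iff)
  then have "pauli_X i [^]\<^bsub>unitary_group\<^esub> nat_of (fst u i) ** pauli_Z i [^]\<^bsub>unitary_group\<^esub> nat_of (snd u i)
      \<sim>\<^sub>p weyl (single i (fst u i), 0) ** weyl (0, single i (snd u i))"
    using pow_phase[of "pauli_X i :: ('k, 'm) qop" "(single i 1, 0)" "nat_of (fst u i)"]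
      pow_phase[of "pauli_Z i :: ('k, 'm) qop" "(0, single i 1)" "nat_of (snd u i)"]
    by (intro phase_eq_mult) (simp_all add: pauli_X_eq_weyl pauli_Z_eq_weyl)
  then have "pauli_X i [^]\<^bsub>unitary_group\<^esub> nat_of (fst u i) ** pauli_Z i [^]\<^bsub>unitary_group\<^esub> nat_of (snd u i)
      \<sim>\<^sub>p weyl ((single i (fst u i), 0) + (0, single i (snd u i)))"
    by (rule phase_eq_trans[OF _ weyl_mult_phase])
  ultimately show ?thesis using represents_phase by fastforce
qed

lemma represents_logical: "represents (logical u) (weyl u)"
proof -
  have "represents (op_prod (factor u) UNIV)
      (weyl (\<lambda>i. if i \<in> UNIV then fst u i else 0, \<lambda>i. if i \<in> UNIV then snd u i else 0))"
  proof (rule op_prod_induct[where P = "\<lambda>J B. represents B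
        (weyl (\<lambda>i. if i \<in> J then fst u i else 0, \<lambda>i. if i \<in> J then snd u i else 0))"])
    have "(\<lambda>i. if i \<in> {} then fst u i else 0, \<lambda>i. if i \<in> {} then snd u i else 0) = 0"
      by (simp add: prod_eq_iff fun_eq_iff)
    then show "represents (mat 1) (weyl (\<lambda>i. if i \<in> {} then fst u i else 0, \<lambda>i. if i \<in> {} then snd u i else 0))"
      by (simp only: weyl_0 represents_one)
  next
    fix j J B
    assume J: "j \<notin> J"
      and B: "represents B (weyl (\<lambda>i. if i \<in> J then fst u i else 0, \<lambda>i. if i \<in> J then snd u i else 0))"
    have eq: "(single j (fst u j), single j (snd u j))
        + (\<lambda>i. if i \<in> J then fst u i else 0, \<lambda>i. if i \<in> J then snd u i else 0)
        = (\<lambda>i. if i \<in> insert j J then fst u i else 0, \<lambda>i. if i \<in> insert j J then snd u i else 0)"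
      using J by (auto simp: prod_eq_iff fun_eq_iff single_def)
    show "represents (factor u j ** B)
      (weyl (\<lambda>i. if i \<in> insert j J then fst u i else 0, \<lambda>i. if i \<in> insert j J then snd u i else 0))"
      unfolding eq[symmetric]
      by (rule represents_phase[OF represents_mult[OF represents_factor B] weyl_mult_phase])
  qed (simp_all add: factor_commute)
  then show ?thesis by (simp add: logical_eq)
qed

lemma represents_coset:
  assumes "g \<in> coset u"
  shows "represents g (weyl u)"
proof -
  obtain s where "s \<in> S" "g = s ** logical u" using assms by (auto simp: coset_eq)
  then show ?thesis using represents_mult[OF represents_S represents_logical] by simp
qed

text \<open>A scalar in the stabilizer fixes a nonzero code vector and so is 1; every other element
  is a phase times a Weyl operator that is not the identity, hence traceless.\<close>

lemma trace_S: "s \<in> S \<Longrightarrow> s \<noteq> mat 1 \<Longrightarrow> trace s = 0"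
proof -
  assume s: "s \<in> S" "s \<noteq> mat 1"
  obtain u c where c: "cmod c = 1" "s = mat c ** weyl u"
    using S_phase[OF s(1)] by (auto simp: phase_eq_def)
  have "u \<noteq> 0"
  proof
    assume "u = 0"
    then have sc: "s = mat c" using c by simp
    obtain v where v: "v \<in> code_space S" "v \<noteq> 0" using code_space_nonzero by blast
    have "c *s v = v" using code_spaceD[OF v(1) s(1)] by (simp add: sc mat_vector_mult)
    moreover obtain i where "v $ i \<noteq> 0" using v(2) by (auto simp: vec_eq_iff)
    ultimately have "c = 1" by (auto simp: vec_eq_iff)
    then show False using sc s(2) by simp
  qed
  then show ?thesis by (simp add: c trace_mat_mult trace_weyl)
qed

text \<open>The centralizer of the stabilizer is generated, up to phases, by the stabilizer and the logical
  generators. A Pauli operator that commutes with all of these is a scalar \<open>c\<close> on the code space, so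
  its product with the sum of the stabilizer group has trace \<open>c m^n \<noteq> 0\<close>, and therefore it is a phase times
  an element of the group.\<close>

lemma scalar_on_code_stabilizer:
  assumes S: "\<And>s. s \<in> S \<Longrightarrow> weyl v ** s = s ** weyl v"
    and X: "\<And>i. sympl v (xp i) = 0" and Z: "\<And>i. sympl v (zp i) = 0"
  shows "\<exists>s\<in>S. weyl v \<sim>\<^sub>p s"
proof -
  define B where "B = dagger V ** weyl v ** V"
  have B: "weyl v ** V = V ** B"
    unfolding B_def by (rule V_compress[OF commute_code_space[OF S]])
  have comm: "B ** P = P ** B" if A: "represents A P" "weyl v ** A = A ** weyl v" for A P
  proof (rule V_cancel)
    obtain c where c: "cmod c = 1" "A ** V = mat c ** (V ** P)"
      using A(1) by (auto simp: represents_def phase_eq_def)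
    have "mat c ** (V ** (B ** P)) = mat c ** ((weyl v ** V) ** P)"
      by (simp only: B matrix_mul_assoc)
    also have "\<dots> = weyl v ** (mat c ** (V ** P))"
      by (simp only: mult_mat_left matrix_mul_assoc[symmetric])
    also have "\<dots> = weyl v ** (A ** V)"
      by (simp only: c(2))
    also have "\<dots> = (A ** weyl v) ** V"
      by (simp only: matrix_mul_assoc A(2))
    also have "\<dots> = (A ** V) ** B"
      by (simp only: matrix_mul_assoc[symmetric] B)
    also have "\<dots> = mat c ** (V ** (P ** B))"
      by (simp only: c mat_mult_assoc matrix_mul_assoc[symmetric])
    finally have "mat (inverse c) ** (mat c ** (V ** (B ** P))) = mat (inverse c) ** (mat c ** (V ** (P ** B)))"
      by (rule arg_cong)
    moreover have "c \<noteq> 0" using c by auto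
    ultimately show "V ** (B ** P) = V ** (P ** B)" by (simp add: mat_mult_mat_left)
  qed
  have "B ** pauli_X i = pauli_X i ** B" "B ** pauli_Z i = pauli_Z i ** B" for i
    by (rule comm[OF represents_X] comm[OF represents_Z]; 
        rule phase_commute[OF phase_eq_refl Xb_phase X] phase_commute[OF phase_eq_refl Zb_phase Z])+
  then obtain c where c: "B = mat c" using commute_all_weyl_scalar by blast
  \<comment> \<open>A zero compression is impossible: \<open>weyl v\<close> is invertible and V is
    not zero.\<close>
  have "c \<noteq> 0"
  proof
    assume "c = 0"
    then have "weyl v ** V = 0" using B c by (simp add: mat_central vec_eq_iff)
    then have "dagger (weyl v) ** (weyl v ** V) = 0" by simp
    then have "V = 0" by (simp add: cancel_dagger)
    then have "(mat 1 :: ('k, 'm) qop) $ undefined $ undefined = 0" using V_isometry by simp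
    then show False by (simp add: mat_vec_index)
  qed
  \<comment> \<open>Left multiplication by a stabilizer permutes S, so the sum over S maps every
    vector into the code space, where \<open>weyl v\<close> acts as c.\<close>
  have "(weyl v ** (\<Sum>s\<in>S. s)) *v x = (mat c ** (\<Sum>s\<in>S. s)) *v x" for x
  proof -
    have "t ** (\<Sum>s\<in>S. s) = (\<Sum>s\<in>S. s)" if t: "t \<in> S" for t
    proof -
      have "t ** (\<Sum>s\<in>S. s) = (\<Sum>s\<in>S. t ** s)" by (rule sum_mat_mult)
      also have "\<dots> = (\<Sum>s\<in>S. s)"
        by (rule sum.reindex_bij_witness[of _ "\<lambda>s. dagger t ** s" "\<lambda>s. t ** s"])
           (use t S_unitary in \<open>auto simp: cancel_dagger S_mult S_dagger\<close>)
      finally show ?thesis .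
    qed
    then have "(\<Sum>s\<in>S. s) *v x \<in> code_space S"
      by (simp add: code_space_def matrix_vector_mul_assoc)
    then obtain w where w: "(\<Sum>s\<in>S. s) *v x = V *v w" using V_range by blast
    have "weyl v *v (V *v w) = (V ** mat c) *v w"
      using B c by (simp add: matrix_vector_mul_assoc)
    also have "\<dots> = mat c *v (V *v w)"
      by (simp add: mat_central matrix_vector_mul_assoc)
    finally show ?thesis using w by (simp add: matrix_vector_mul_assoc[symmetric])
  qed
  then have eq: "weyl v ** (\<Sum>s\<in>S. s) = mat c ** (\<Sum>s\<in>S. s)" by (simp add: matrix_eq)
  have tr: "trace (\<Sum>s\<in>T. f s) = (\<Sum>s\<in>T. trace (f s))" for T and f :: "('n, 'm) qop \<Rightarrow> ('n, 'm) qop"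
    by (induction T rule: infinite_finite_induct) (simp_all add: trace_add trace_0[unfolded mat_0])
  have "(\<Sum>s\<in>S. trace (weyl v ** s)) = c * (\<Sum>s\<in>S. trace s)"
    using arg_cong[OF eq, of trace] by (simp add: sum_mat_mult tr trace_mat_mult sum_distrib_left)
  also have "(\<Sum>s\<in>S. trace s) = (\<Sum>s\<in>{mat 1 :: ('n, 'm) qop}. trace s)"
    by (rule sum.mono_neutral_right) (use S_finite S_one trace_S in auto)
  finally have "(\<Sum>s\<in>S. trace (weyl v ** s)) \<noteq> 0"
    using \<open>c \<noteq> 0\<close> by (simp add: trace_def mat_vec_index)
  \<comment> \<open>The product of \<open>weyl v\<close> and s has nonzero trace, so its phase point
    is 0 and s is inverse to \<open>weyl v\<close> up to phase.\<close>
  then obtain s where s: "s \<in> S" "trace (weyl v ** s) \<noteq> 0" by (meson sum.not_neutral_contains_not_neutral)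
  obtain u where u: "s \<sim>\<^sub>p weyl u" using S_phase s by blast
  have "weyl v ** s \<sim>\<^sub>p weyl (v + u)"
    by (rule phase_eq_trans[OF phase_eq_mult[OF phase_eq_refl u] weyl_mult_phase])
  then have "v + u = 0"
    using s(2) by (auto simp: phase_eq_def trace_mat_mult trace_weyl split: if_splits)
  then have "v = - u" by (simp add: eq_neg_iff_add_eq_0)
  then have "weyl v \<sim>\<^sub>p dagger s"
    using phase_eq_sym[OF phase_eq_trans[OF phase_eq_dagger[OF u] dagger_weyl_phase]] by simp
  then show ?thesis using S_dagger s(1) by blast
qed

text \<open>Dividing by a suitable logical Pauli leaves a Weyl operator commuting with the
  stabilizer and all logical generators, which is a stabilizer up to phase.\<close>

lemma centralizer:
  assumes S: "\<And>s. s \<in> S \<Longrightarrow> weyl v ** s = s ** weyl v"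
  shows "\<exists>u. \<exists>g\<in>coset u. weyl v \<sim>\<^sub>p g"
proof -
  \<comment> \<open>Chosen so that \<open>lift u\<close> has the same pairings with all
    \<open>xp\<close> and \<open>zp\<close> as v; the remainder w then pairs to zero with
    them.\<close>
  define u where "u = (\<lambda>i. - sympl v (zp i), \<lambda>i. sympl v (xp i))"
  define w where "w = v - lift u"
  have log_comm: "logical u ** s = s ** logical u" if s: "s \<in> S" for s
  proof -
    obtain t where t: "s \<sim>\<^sub>p weyl t" using S_phase s by blast
    have "sympl (xp i) t = 0" "sympl (zp i) t = 0" for i
      using phase_commute_iff[OF Xb_phase[of i] t, of 0] phase_commute_iff[OF Zb_phase[of i] t, of 0]
        S_commute[OF s, of i] by simp_all
    then have "sympl (lift u) t = 0"
      by (simp add: lift_def sympl_sum sympl_add)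
    then show ?thesis by (rule phase_commute[OF logical_phase t])
  qed
  have "weyl v ** dagger (logical u) \<sim>\<^sub>p weyl v ** weyl (- lift u)"
    by (intro phase_eq_mult phase_eq_refl phase_eq_trans[OF phase_eq_dagger[OF logical_phase] dagger_weyl_phase])
  also have "\<dots> \<sim>\<^sub>p weyl w" unfolding w_def using weyl_mult_phase[of v "- lift u"] by simp
  finally have w: "weyl v ** dagger (logical u) \<sim>\<^sub>p weyl w" .
  have lu: "unitary (logical u)" by (rule phase_eq_unitary[OF logical_phase unitary_weyl])
  have "\<exists>s\<in>S. weyl w \<sim>\<^sub>p s"
  proof (rule scalar_on_code_stabilizer)
    show "weyl w ** s = s ** weyl w" if s: "s \<in> S" for s
    proof -
      have "dagger (logical u) ** s = s ** dagger (logical u)"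
      proof -
        have "dagger (logical u ** dagger s) = dagger (dagger s ** logical u)"
          using log_comm[OF S_dagger[OF s]] by simp
        then show ?thesis by (simp add: dagger_mult)
      qed
      then have "(weyl v ** dagger (logical u)) ** s = s ** (weyl v ** dagger (logical u))"
        by (rule commute_mult[OF S[OF s]])
      then show ?thesis using commute_phase[OF phase_eq_sym[OF w], of s] by simp
    qed
  qed (simp_all add: w_def sympl_diff sympl_lift u_def)
  then obtain s where s: "s \<in> S" "weyl w \<sim>\<^sub>p s" by blast
  have "weyl v = (weyl v ** dagger (logical u)) ** logical u"
    by (simp add: cancel_dagger lu)
  also have "\<dots> \<sim>\<^sub>p s ** logical u"
    by (intro phase_eq_mult phase_eq_refl phase_eq_trans[OF w s(2)])
  finally show ?thesis
    using s(1) by (intro exI[of _ u] bexI[of _ "s ** logical u"]) (auto simp: coset_eq)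
qed

text \<open>A stabilizer is absorbed by V on the right and by \<open>dagger V\<close> on the left.
  Passing it across \<open>weyl v\<close> multiplies the compression by a phase different from
  1.\<close>

lemma compress_not_commuting:
  assumes "s \<in> S" "weyl v ** s \<noteq> s ** weyl v"
  shows "dagger V ** weyl v ** V = 0"
proof -
  obtain t where t: "s \<sim>\<^sub>p weyl t" using S_phase assms by blast
  have nz: "sympl v t \<noteq> 0" using assms(2) phase_commute[OF phase_eq_refl t] by blast
  have comm: "weyl v ** s = mat (chi (sympl v t)) ** (s ** weyl v)"
    using phase_commute_iff[OF phase_eq_refl t] by blast
  have Vs: "dagger V ** s = dagger V"
    using arg_cong[OF V_stabilized[OF S_dagger[OF assms(1)]], of dagger] by (simp add: dagger_mult)
  have "dagger V ** weyl v ** V = dagger V ** (weyl v ** s) ** V"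
    by (simp only: matrix_mul_assoc[symmetric] V_stabilized[OF assms(1)])
  also have "\<dots> = mat (chi (sympl v t)) ** (dagger V ** s ** weyl v ** V)"
    by (simp only: comm mult_mat_left mat_mult_assoc matrix_mul_assoc[of "dagger V"])
  also have "\<dots> = mat (chi (sympl v t)) ** (dagger V ** weyl v ** V)"
    by (simp only: Vs)
  finally have eq: "dagger V ** weyl v ** V = mat (chi (sympl v t)) ** (dagger V ** weyl v ** V)" .
  have "(dagger V ** weyl v ** V) $ f $ g = 0" for f g
    using arg_cong[OF eq, of "\<lambda>A. A $ f $ g"] nz by (simp only: mat_mult_index) (simp add: chi_eq_1_iff)
  then show ?thesis by (simp add: vec_eq_iff)
qed

end

end

subsection \<open>Existence of the identification\<close>

lemma sum_matrix_vector_mult: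
  "(\<Sum>i\<in>I. A i) *v v = (\<Sum>i\<in>I. (A i :: complex^'a::finite^'b::finite) *v v)"
  by (induction I rule: infinite_finite_induct) (simp_all add: matrix_vector_mult_add_rdistrib)

lemma mat_pow:
  "(mat c ** A) [^]\<^bsub>unitary_group\<^esub> (t :: nat) = mat (c ^ t) ** ((A :: complex^'a::finite^'a) [^]\<^bsub>unitary_group\<^esub> t)"
  by (induction t) (simp_all add: mat_mult_assoc mult_mat_left[of _ c] mat_mult_mat_left mult.commute)

lemma commute_pow:
  assumes "A ** W = W ** (A :: complex^'a::finite^'a)"
  shows "A [^]\<^bsub>unitary_group\<^esub> (t :: nat) ** W = W ** A [^]\<^bsub>unitary_group\<^esub> t"
  by (induction t) (simp_all add: commute_mult[OF _ assms])

lemma of_nat_card_eq_0: "of_nat CARD('m) = (0 :: 'm::nontriv mod_ring)"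
  by (simp add: of_nat_of_int_mod_ring) (transfer, simp)

lemma phase_root:
  assumes "cmod c = 1" "m > 0"
  shows "\<exists>d. cmod d = 1 \<and> d ^ m = c"
proof -
  have "c \<noteq> 0" using assms(1) by auto
  then have "cis (Arg c) = c"
    using cis_Arg[of c] assms(1) by (simp add: sgn_eq)
  moreover have "cis (Arg c / real m) ^ m = cis (Arg c)"
    using assms(2) Complex.DeMoivre[of "Arg c / real m" m] by simp
  ultimately show ?thesis by (intro exI[of _ "cis (Arg c / real m)"]) simp
qed

text \<open>The m-th power of a Pauli is a scalar phase, and dividing by an m-th root of it makes
  powers periodic mod m.\<close>

lemma normalize_phase:
  fixes A :: "('q::finite, 'm::nontriv) qop"
  assumes "A \<sim>\<^sub>p weyl u"
  shows "\<exists>A'. A' \<sim>\<^sub>p A \<and> A' [^]\<^bsub>unitary_group\<^esub> CARD('m) = mat 1"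
proof -
  have "A [^]\<^bsub>unitary_group\<^esub> CARD('m) \<sim>\<^sub>p mat 1"
    using pow_phase[OF assms, of "CARD('m)"] by (simp add: of_nat_card_eq_0)
  then obtain c where c: "cmod c = 1" "A [^]\<^bsub>unitary_group\<^esub> CARD('m) = mat c"
    by (auto simp: phase_eq_def)
  then obtain d where d: "cmod d = 1" "d ^ CARD('m) = inverse c"
    using phase_root[of "inverse c" "CARD('m)"] by (auto simp: norm_inverse)
  have "c \<noteq> 0" using c(1) by auto
  then show ?thesis
    using c d by (intro exI[of _ "mat d ** A"]) (simp add: phase_eq_mat mat_pow mat_mult_mat)
qed

definition mpow :: "complex^'a^'a \<Rightarrow> 'm::nontriv mod_ring \<Rightarrow> complex^'a^'a" where
  "mpow A x = A [^]\<^bsub>unitary_group\<^esub> nat_of x"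

lemma mpow_0 [simp]: "mpow A 0 = mat 1"
  by (simp add: mpow_def nat_of_def)

lemma mpow_add_1:
  assumes "A [^]\<^bsub>unitary_group\<^esub> CARD('m) = mat 1"
  shows "A ** mpow A x = mpow (A :: complex^'a::finite^'a) (x + 1 :: 'm::nontriv mod_ring)"
proof -
  have "A ** mpow A x = A [^]\<^bsub>unitary_group\<^esub> Suc (nat_of x)"
    using commute_pow[of A A "nat_of x"] by (simp add: mpow_def)
  also have "\<dots> = mpow A (x + 1)"
  proof (cases "Suc (nat_of x) < CARD('m)")
    case True
    then show ?thesis by (simp add: mpow_def nat_of_add)
  next
    case False
    then have "Suc (nat_of x) = CARD('m)" using nat_of_less[of x] by simp
    then have "nat_of (x + 1) = 0" by (simp add: nat_of_add del: nat_of_eq_0_iff)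
    then show ?thesis using assms \<open>Suc (nat_of x) = CARD('m)\<close> by (simp only: mpow_def) simp
  qed
  finally show ?thesis .
qed

lemma sum_chi_mult:
  "(\<Sum>z\<in>UNIV. chi (- z * x)) = (if x = 0 then of_nat CARD('m) else 0)"
  for x :: "'m::nontriv mod_ring"
proof (cases "x = 0")
  case False
  then show ?thesis
    using sum_chi_hom_eq_0[of "\<lambda>z. - z * x" 1] by (simp add: algebra_simps)
qed simp

text \<open>P is a discrete Fourier sum of the powers of A, that is m times the projection onto the
  eigenspace for \<open>chi z\<close>. Being a polynomial in A, it commutes with whatever A commutes
  with.\<close>

lemma eigenprojection:
  fixes A :: "complex^'a::finite^'a"
  assumes A: "A [^]\<^bsub>unitary_group\<^esub> CARD('m) = mat 1" and v: "v \<noteq> 0"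
  shows "\<exists>P (z :: 'm::nontriv mod_ring). (\<forall>B. A ** B = B ** A \<longrightarrow> P ** B = B ** P)
    \<and> P *v v \<noteq> 0 \<and> A ** P = mat (chi z) ** P"
proof -
  define P where "P z = (\<Sum>x\<in>UNIV. mat (chi (- z * x)) ** mpow A x)" for z :: "'m mod_ring"
  have comm: "P z ** B = B ** P z" if "A ** B = B ** A" for z B
    using commute_pow[OF that] by (simp add: P_def sum_mat_mult mat_mult_assoc mult_mat_left mpow_def)
  have eig: "A ** P z = mat (chi z) ** P z" for z
  proof -
    have "A ** P z = (\<Sum>x\<in>UNIV. mat (chi (- z * x)) ** mpow A (x + 1))"
      by (simp add: P_def sum_mat_mult mult_mat_left[of A] mpow_add_1[OF A])
    also have "\<dots> = (\<Sum>x\<in>UNIV. mat (chi (- z * (x - 1))) ** mpow A x)"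
      by (rule sum.reindex_bij_witness[of _ "\<lambda>x. x - 1" "\<lambda>x. x + 1"]) auto
    also have "\<dots> = (\<Sum>x\<in>UNIV. mat (chi z) ** (mat (chi (- z * x)) ** mpow A x))"
      by (simp only: mat_mult_mat_left chi_add[symmetric]) (simp add: algebra_simps)
    also have "\<dots> = mat (chi z) ** P z"
      by (simp only: P_def sum_mat_mult)
    finally show ?thesis .
  qed
  have "\<exists>z. P z *v v \<noteq> 0"
  proof (rule ccontr)
    assume "\<not> ?thesis"
    then have 0: "P z *v v = 0" for z by blast
    \<comment> \<open>Summing over all z keeps only the power x = 0, so the P z add up to m times
      the identity and cannot all kill v.\<close>
    have "(\<Sum>z\<in>UNIV. (P z *v v) $ i) = of_nat CARD('m) * v $ i" for i
    proof -
      have Pz: "(P z *v v) $ i = (\<Sum>x\<in>UNIV. chi (- z * x) * (mpow A x *v v) $ i)" for z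
        by (simp add: P_def sum_matrix_vector_mult mat_vec_mult)
      have "(\<Sum>z\<in>UNIV. (P z *v v) $ i)
          = (\<Sum>x\<in>(UNIV :: 'm mod_ring set). (\<Sum>z\<in>UNIV. chi (- z * x)) * (mpow A x *v v) $ i)"
        unfolding Pz sum_distrib_right by (rule sum.swap)
      also have "\<dots> = (\<Sum>x\<in>(UNIV :: 'm mod_ring set). if x = 0 then of_nat CARD('m) * v $ i else 0)"
        by (intro sum.cong refl) (simp only: sum_chi_mult, simp)
      finally show ?thesis by (simp add: sum.delta)
    qed
    then have "v $ i = 0" for i by (simp add: 0)
    then show False using v by (simp add: vec_eq_iff)
  qed
  then show ?thesis using comm eig by blast
qed

context stabilizer_code_with_logicals
begin

text \<open>Projecting onto an eigenspace of the next Z operator keeps the vector in the code and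
  keeps the earlier eigenvalue equations, since the projection commutes with the stabilizer and with
  all the \<open>Zb i\<close>.\<close>

lemma joint_eigenvector:
  assumes "finite I"
  shows "\<exists>v\<in>code_space S. v \<noteq> 0 \<and> (\<forall>i\<in>I. \<exists>c. cmod c = 1 \<and> Zb i *v v = c *s v)"
  using assms
proof induction
  case empty
  show ?case using code_space_nonzero by blast
next
  case (insert j I)
  then obtain v where v: "v \<in> code_space S" "v \<noteq> 0"
    and ev: "\<And>i. i \<in> I \<Longrightarrow> \<exists>c. cmod c = 1 \<and> Zb i *v v = c *s v" by blast
  obtain A where A: "A \<sim>\<^sub>p Zb j" "A [^]\<^bsub>unitary_group\<^esub> CARD('m) = mat 1"
    using normalize_phase[OF Zb_phase] by blast
  obtain P and z :: "'m mod_ring" where P: "\<And>B. A ** B = B ** A \<Longrightarrow> P ** B = B ** P"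
    and Pv: "P *v v \<noteq> 0" and AP: "A ** P = mat (chi z) ** P"
    using eigenprojection[OF A(2) v(2)] by blast
  have PZ: "P ** B = B ** P" if "Zb j ** B = B ** Zb j" for B
    by (rule P, rule commute_phase[OF A(1), symmetric]) (rule that[symmetric])
  have 1: "P *v v \<in> code_space S"
    by (rule commute_code_space[OF _ v(1)]) (rule PZ, rule S_commute)
  have "\<exists>c. cmod c = 1 \<and> Zb i *v (P *v v) = c *s (P *v v)" if i: "i \<in> insert j I" for i
  proof (cases "i = j")
    case True
    obtain c where c: "cmod c = 1" "Zb j = mat c ** A"
      using phase_eq_sym[OF A(1)] by (auto simp: phase_eq_def)
    have "Zb j ** P = mat (c * chi z) ** P"
      by (simp only: c mat_mult_assoc AP mat_mult_mat_left)
    then have "Zb j *v (P *v v) = (c * chi z) *s (P *v v)"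
      by (simp only: matrix_vector_mul_assoc mat_vec_mult)
    then show ?thesis using c(1) True by (intro exI[of _ "c * chi z"]) (simp add: norm_mult)
  next
    case False
    then obtain c where c: "cmod c = 1" "Zb i *v v = c *s v" using ev i by blast
    have "P ** Zb i = Zb i ** P"
      by (rule PZ, rule phase_commute[OF Zb_phase Zb_phase]) (simp add: sympl_logical)
    then have "Zb i *v (P *v v) = P *v (c *s v)"
      by (simp add: matrix_vector_mul_assoc c(2)[symmetric])
    then show ?thesis using c(1) by (auto simp: vector_scalar_commute)
  qed
  then show ?case using 1 Pv by blast
qed

text \<open>The joint eigenvector v plays the role of the basis state 0, and the logical X powers
  applied to v give the other columns. Their Gram matrix commutes with all Paulis, hence is a
  scalar, so rescaling gives an isometry; a dimension count shows that it is onto the code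
  space.\<close>

lemma identification_exists: "\<exists>V. code_identification S Xb Zb V"
proof -
  obtain v where v: "v \<in> code_space S" "v \<noteq> 0"
    and ev: "\<And>i. \<exists>c. cmod c = 1 \<and> Zb i *v v = c *s v"
    using joint_eigenvector[of UNIV] by auto
  obtain \<mu> where \<mu>: "\<And>i. cmod (\<mu> i) = 1" "\<And>i. Zb i *v v = \<mu> i *s v"
    using ev by metis
  have "\<exists>A. A \<sim>\<^sub>p Xb i \<and> A [^]\<^bsub>unitary_group\<^esub> CARD('m) = mat 1" for i
    by (rule normalize_phase[OF Xb_phase])
  \<comment> \<open>Normalized so that exponents may wrap around mod m; otherwise adding 1 to an
    exponent could introduce a phase depending on the column.\<close>
  then obtain X where X: "\<And>i. X i \<sim>\<^sub>p Xb i" "\<And>i. X i [^]\<^bsub>unitary_group\<^esub> CARD('m) = mat 1"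
    by metis
  define F where "F a i = mpow (X i) (a i)" for a :: "'k \<Rightarrow> 'm mod_ring" and i
  define P where "P a = op_prod (F a) UNIV" for a
  have F_phase: "F a i \<sim>\<^sub>p weyl (scale (a i) (xp i))" for a i
    using pow_phase[OF phase_eq_trans[OF X(1) Xb_phase], of i "nat_of (a i)"]
    by (simp add: F_def mpow_def)
  have F_comm: "F a i ** F a j = F a j ** F a i" for a i j
    by (rule phase_commute[OF F_phase F_phase]) (simp add: sympl_logical)
  have P_phase: "P a \<sim>\<^sub>p weyl (\<Sum>i\<in>UNIV. scale (a i) (xp i))" for a
    unfolding P_def by (rule op_prod_phase[OF _ F_phase]) (simp_all add: sympl_logical)
  have P_step: "X i ** P a = P (a(i := a i + 1))" for i a
  proof -
    have "P (a(i := a i + 1)) = F (a(i := a i + 1)) i ** op_prod (F (a(i := a i + 1))) (UNIV - {i})"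
      unfolding P_def by (rule op_prod_remove[OF F_comm]) auto
    also have "op_prod (F (a(i := a i + 1))) (UNIV - {i}) = op_prod (F a) (UNIV - {i})"
      by (rule op_prod_cong[OF F_comm]) (auto simp: F_def)
    also have "F (a(i := a i + 1)) i = X i ** F a i"
      by (simp add: F_def mpow_add_1[OF X(2)])
    also have "X i ** F a i ** op_prod (F a) (UNIV - {i}) = X i ** (F a i ** op_prod (F a) (UNIV - {i}))"
      by (simp only: matrix_mul_assoc)
    also have "F a i ** op_prod (F a) (UNIV - {i}) = P a"
      unfolding P_def by (rule op_prod_remove[OF F_comm, symmetric]) auto
    finally show ?thesis by (rule sym)
  qed
  define W :: "complex ^ ('k \<Rightarrow> 'm mod_ring) ^ ('n \<Rightarrow> 'm mod_ring)"
    where "W = (\<chi> h a. (P a *v v) $ h)"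
  have mult_W: "(A ** W) $ h $ a = (A *v (P a *v v)) $ h" for A :: "('n, 'm) qop" and h a
    by (simp add: W_def matrix_matrix_mult_def matrix_vector_mult_def)
  have WX: "Xb i ** W \<sim>\<^sub>p W ** pauli_X i" for i
  proof -
    have "X i ** W = W ** pauli_X i"
    proof -
      have "g + single i 1 = g(i := g i + 1)" for g :: "'k \<Rightarrow> 'm mod_ring"
        by (auto simp: single_def fun_eq_iff)
      then have "(X i ** W) $ h $ a = (W ** pauli_X i) $ h $ a" for h a
        by (simp add: mult_W pauli_X_eq_weyl mult_weyl_index matrix_vector_mul_assoc P_step)
           (simp add: W_def)
      then show ?thesis by (simp add: vec_eq_iff)
    qed
    then show ?thesis using phase_eq_mult[OF phase_eq_sym[OF X(1)] phase_eq_refl, of i W] by simp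
  qed
  \<comment> \<open>The eigenvalue of \<open>Zb i\<close> on v is an arbitrary phase, the same for
    all columns; \<open>chi (a i)\<close> comes from moving \<open>Zb i\<close> past
    \<open>P a\<close>.\<close>
  have WZ: "Zb i ** W = mat (\<mu> i) ** (W ** pauli_Z i)" for i
  proof -
    have "(Zb i ** W) $ h $ a = (mat (\<mu> i) ** (W ** pauli_Z i)) $ h $ a" for h a
    proof -
      have "sympl (zp i) (\<Sum>j\<in>UNIV. scale (a j) (xp j)) = a i"
        by (simp add: sympl_sum sympl_logical if_distrib[of "\<lambda>x. _ * x"] sum.delta sum.delta' cong: if_cong)
      then have "Zb i ** P a = mat (chi (a i)) ** (P a ** Zb i)"
        using phase_commute_iff[OF Zb_phase P_phase] by blast
      then have "Zb i *v (P a *v v) = chi (a i) *s (P a *v (\<mu> i *s v))"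
        by (simp add: matrix_vector_mul_assoc mat_vec_mult \<mu>(2)[symmetric])
      also have "\<dots> = (chi (a i) * \<mu> i) *s (P a *v v)"
        by (simp add: vector_scalar_commute)
      finally show ?thesis
        by (simp add: mult_W pauli_Z_eq_weyl mult_weyl_index) (simp add: W_def)
    qed
    then show ?thesis by (simp add: vec_eq_iff)
  qed
  have WZ': "Zb i ** W \<sim>\<^sub>p W ** pauli_Z i" for i
    using WZ \<mu>(1) phase_eq_mat by metis
  have gram: "(dagger W ** W) ** p = p ** (dagger W ** W)"
    if p: "unitary p" and A: "unitary A" "A ** W \<sim>\<^sub>p W ** p" for A p
  proof -
    obtain c where c: "cmod c = 1" "A ** W = mat c ** (W ** p)" using A(2) by (auto simp: phase_eq_def)
    have "dagger W ** W = dagger (A ** W) ** (A ** W)"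
      by (simp add: dagger_mult matrix_mul_assoc[symmetric] cancel_dagger[OF A(1)])
    also have "\<dots> = mat (cnj c * c) ** (dagger (W ** p) ** (W ** p))"
      by (simp only: c dagger_mat_mult mat_mult_assoc mult_mat_left[of "dagger _"] mat_mult_mat_left)
    also have "cnj c * c = 1" using c(1) by (simp add: complex_norm_square[symmetric] mult.commute)
    also have "mat 1 ** (dagger (W ** p) ** (W ** p)) = dagger p ** (dagger W ** W) ** p"
      by (simp only: dagger_mult matrix_mul_assoc matrix_mul_lid)
    finally have "dagger W ** W = dagger p ** (dagger W ** W) ** p" .
    then have "p ** (dagger W ** W) = p ** (dagger p ** (dagger W ** W) ** p)"
      by (rule arg_cong)
    also have "\<dots> = (dagger W ** W) ** p"
      by (simp only: matrix_mul_assoc unitaryD(2)[OF p] matrix_mul_lid)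
    finally show ?thesis by (rule sym)
  qed
  obtain c where c: "dagger W ** W = mat c"
  proof -
    have "unitary (pauli_X i :: ('k, 'm) qop)" "unitary (pauli_Z i :: ('k, 'm) qop)" for i
      by (simp_all add: pauli_X_eq_weyl pauli_Z_eq_weyl)
    then show thesis
      using commute_all_weyl_scalar[OF gram[OF _ Xb_unitary WX] gram[OF _ Zb_unitary WZ']] that by blast
  qed
  \<comment> \<open>The Gram scalar is the squared norm of the column at 0, so it is real and
    positive.\<close>
  define r where "r = (\<Sum>h\<in>UNIV. (cmod ((P 0 *v v) $ h))\<^sup>2)"
  have cr: "c = of_real r"
  proof -
    have "c = (dagger W ** W) $ 0 $ 0" by (simp add: c mat_vec_index)
    also have "\<dots> = (\<Sum>h\<in>UNIV. cnj ((P 0 *v v) $ h) * (P 0 *v v) $ h)"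
      by (simp add: matrix_matrix_mult_def W_def)
    also have "\<dots> = of_real r"
      by (simp add: r_def complex_norm_square mult.commute del: of_real_power)
    finally show ?thesis .
  qed
  have "r > 0"
  proof -
    have "unitary (P 0)" using P_phase phase_eq_unitary unitary_weyl by blast
    then have "dagger (P 0) *v (P 0 *v v) = v" by (simp add: matrix_vector_mul_assoc unitaryD)
    then have "P 0 *v v \<noteq> 0" using v(2) by auto
    then obtain h where "(P 0 *v v) $ h \<noteq> 0" by (auto simp: vec_eq_iff)
    then show ?thesis unfolding r_def by (intro sum_pos2[of _ h]) auto
  qed
  define d where "d = (of_real (1 / sqrt r) :: complex)"
  define V where "V = mat d ** W"
  have isom: "dagger V ** V = mat 1"
  proof -
    have "dagger V ** V = mat (cnj d * d) ** (dagger W ** W)"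
      by (simp only: V_def dagger_mat_mult mat_mult_assoc mult_mat_left[of "dagger _"] mat_mult_mat_left)
    also have "\<dots> = mat (cnj d * d * c)" by (simp only: c mat_mult_mat)
    also have "cnj d * d * c = of_real (1 / sqrt r * (1 / sqrt r) * r)"
      by (simp only: d_def cr complex_cnj_complex_of_real of_real_mult)
    also have "1 / sqrt r * (1 / sqrt r) * r = 1" using \<open>r > 0\<close> by simp
    finally show ?thesis by simp
  qed
  have S_W: "s ** V = V" if s: "s \<in> S" for s
  proof -
    have "(s ** W) $ h $ a = W $ h $ a" for h a
    proof -
      obtain t where t: "s \<sim>\<^sub>p weyl t" using S_phase s by blast
      have "sympl (xp i) t = 0" for i
        using phase_commute_iff[OF Xb_phase[of i] t, of 0] S_commute(1)[OF s, of i] by simp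
      then have "P a ** s = s ** P a"
        by (intro phase_commute[OF P_phase t]) (simp add: sympl_sum)
      then have "s *v (P a *v v) = P a *v (s *v v)" by (simp add: matrix_vector_mul_assoc)
      then show ?thesis using code_spaceD[OF v(1) s] by (simp add: mult_W) (simp add: W_def)
    qed
    then have "s ** W = W" by (simp add: vec_eq_iff)
    then show ?thesis by (simp add: V_def mult_mat_left)
  qed
  have range: "range ((*v) V) = code_space S"
  proof (rule vec.subspace_dim_equal)
    have lin: "Vector_Spaces.linear (*s) (*s) ((*v) V)" by (rule matrix_vector_mul_linear_gen)
    show "vec.subspace (range ((*v) V))"
      using vec.subspace_image[of UNIV V] by simp
    show "vec.subspace (code_space S)"
      by (auto simp: vec.subspace_def code_space_def matrix_vector_right_distrib vector_scalar_commute)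
    show "range ((*v) V) \<subseteq> code_space S"
      using S_W by (auto simp: code_space_def matrix_vector_mul_assoc)
    have "inj ((*v) V)"
    proof (rule inj_on_inverseI)
      show "dagger V *v (V *v x) = x" for x by (simp add: matrix_vector_mul_assoc isom)
    qed
    then have "vec.dim (range ((*v) V)) = vec.dim (UNIV :: ('k, 'm) ket set)"
      by (intro vec.dim_image_eq[OF lin]) (auto intro: inj_on_subset)
    also have "\<dots> = CARD('m) ^ CARD('k)"
      by (simp add: vec.dim_UNIV card_cart_basis card_fun)
    also have "\<dots> = vec.dim (code_space S)" using code by (simp add: stabilizer_code_def)
    finally show "vec.dim (code_space S) \<le> vec.dim (range ((*v) V))" by simp
  qed
  have "Xb i ** V \<sim>\<^sub>p V ** pauli_X i" "Zb i ** V \<sim>\<^sub>p V ** pauli_Z i" for i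
    using phase_eq_mult[OF phase_eq_refl WX, of "mat d" i] phase_eq_mult[OF phase_eq_refl WZ', of "mat d" i]
    by (simp_all add: V_def mat_mult_assoc mult_mat_left[of "Xb i"] mult_mat_left[of "Zb i"])
  then show ?thesis
    using isom range by (auto simp: code_identification_def phase_eq_def matrix_mul_assoc)
qed

end

subsection \<open>Descent along commutators\<close>

lemma double_count_overlap:
  assumes "finite A" "finite R"
  shows "(\<Sum>a\<in>A. card (s a \<inter> R)) = (\<Sum>i\<in>R. card {a \<in> A. i \<in> s a})"
proof -
  have "(\<Sum>a\<in>A. card (s a \<inter> R)) = (\<Sum>a\<in>A. \<Sum>i\<in>R. if i \<in> s a then 1 else 0)"
    using assms by (intro sum.cong refl) (simp add: sum.If_cases Int_commute)
  also have "\<dots> = (\<Sum>i\<in>R. \<Sum>a\<in>A. if i \<in> s a then 1 else 0)" by (rule sum.swap)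
  also have "\<dots> = (\<Sum>i\<in>R. card {a \<in> A. i \<in> s a})"
    using assms by (intro sum.cong refl) (simp add: sum.If_cases Int_def)
  finally show ?thesis .
qed

lemma c_disjointness_attained:
  assumes "finite G"
  obtains A where "A \<subseteq> G" "c_disjoint Q N c A" "c_disjointness Q N c G = real (card A) / real c"
proof -
  let ?C = "{card A | A. A \<subseteq> G \<and> c_disjoint Q N c A}"
  have "?C \<subseteq> card ` Pow G" by auto
  then have "finite ?C" using assms by (meson finite_Pow_iff finite_imageI finite_subset)
  moreover have "c_disjoint Q N c {}" by (simp add: c_disjoint_def)
  then have "?C \<noteq> {}" by blast
  ultimately have "Max ?C \<in> ?C" by (rule Max_in)
  then obtain A where "A \<subseteq> G" "c_disjoint Q N c A" "Max ?C = card A" by auto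
  then show ?thesis using that by (simp add: c_disjointness_def)
qed

text \<open>Because B is invertible, K maps the range of V onto itself, and so does its
  inverse.\<close>

lemma intertwine_dagger:
  assumes "unitary K" "unitary B" "K ** V = V ** (B :: complex^'a::finite^'a)"
  shows "dagger K ** V = V ** dagger B"
proof -
  have "V ** dagger B = dagger K ** (K ** V) ** dagger B"
    by (simp add: cancel_dagger(1)[OF assms(1)])
  also have "\<dots> = dagger K ** V ** (B ** dagger B)"
    by (simp only: assms(3) matrix_mul_assoc)
  finally show ?thesis by (simp add: unitaryD[OF assms(2)])
qed

lemma intertwine_mult:
  assumes "K ** V = V ** B" "L ** V = V ** (C :: complex^'a::finite^'a)"
  shows "(K ** L) ** V = V ** (B ** C)"
proof -
  have "(K ** L) ** V = (K ** V) ** C" by (simp only: matrix_mul_assoc[symmetric] assms(2))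
  then show ?thesis by (simp only: assms(1) matrix_mul_assoc)
qed

lemma intertwine_comm:
  assumes "unitary K" "unitary B" "K ** V = V ** (B :: complex^'a::finite^'a)"
    and "unitary L" "unitary C" "L ** V = V ** C"
  shows "group_comm K L ** V = V ** group_comm B C"
  unfolding group_comm_def using assms by (intro intertwine_mult intertwine_dagger)

context stabilizer_code_with_logicals
begin

section \<open>Distances and overlaps of logical representatives\<close>

context
  fixes Q :: "nat \<Rightarrow> 'n set" and N :: nat
begin

private abbreviation "L \<equiv> nontrivial_logical_paulis S Xb Zb"

lemma finite_coset: "finite (coset u)" and coset_nonempty: "coset u \<noteq> {}"
  using S_finite S_one by (auto simp: coset_eq)

lemma finite_logicals: "finite L"
  by (simp add: nontrivial_logical_paulis_eq)

lemma coset_in_logicals: "u \<noteq> 0 \<Longrightarrow> coset u \<in> L"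
  by (auto simp: nontrivial_logical_paulis_eq)

lemma logicals_nonempty: "L \<noteq> {}"
proof -
  have "(single undefined 1, 0) \<noteq> (0 :: ('k, 'm) phase_point)"
    by (auto simp: prod_eq_iff fun_eq_iff single_def)
  then show ?thesis using coset_in_logicals by blast
qed

lemma logicalsE:
  assumes "G \<in> L"
  obtains u where "u \<noteq> 0" "G = coset u"
  using assms by (auto simp: nontrivial_logical_paulis_eq)

lemma min_distance_le:
  assumes "u \<noteq> 0" "g \<in> coset u"
  shows "min_distance Q N L \<le> card (supp Q N g)"
proof -
  have "min_distance Q N L \<le> coset_distance Q N (coset u)"
    unfolding min_distance_def using finite_logicals coset_in_logicals[OF assms(1)] by (intro Min_le) auto
  also have "\<dots> \<le> card (supp Q N g)"
    unfolding coset_distance_def using finite_coset assms(2) by (intro Min_le) auto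
  finally show ?thesis .
qed

lemma max_distance_ge:
  assumes "u \<noteq> 0"
  shows "\<exists>g\<in>coset u. card (supp Q N g) \<le> max_distance Q N L"
proof -
  have "coset_distance Q N (coset u) \<in> (\<lambda>g. card (supp Q N g)) ` coset u"
    unfolding coset_distance_def using finite_coset coset_nonempty by (intro Min_in) auto
  then obtain g where "g \<in> coset u" "coset_distance Q N (coset u) = card (supp Q N g)" by auto
  moreover have "coset_distance Q N (coset u) \<le> max_distance Q N L"
    unfolding max_distance_def using finite_logicals coset_in_logicals[OF assms(1)] by (intro Max_ge) auto
  ultimately show ?thesis by auto
qed

lemma min_le_max_distance: "min_distance Q N L \<le> max_distance Q N L"
proof -
  obtain G where "G \<in> L" using logicals_nonempty by blast
  then obtain u where "u \<noteq> 0" "G = coset u" by (rule logicalsE)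
  then show ?thesis using min_distance_le max_distance_ge by (meson order_trans)
qed

text \<open>The supremum of reals dominates its term at c = 1 only once the terms are bounded above;
  the size of one coset is such a bound.\<close>

lemma disjointness_nonneg: "0 \<le> disjointness Q N L"
proof -
  obtain G where G: "G \<in> L" using logicals_nonempty by blast
  then obtain u where "u \<noteq> 0" and u: "G = coset u" by (rule logicalsE)
  have ub: "Min (c_disjointness Q N c ` L) \<le> real (card G)" if "c \<ge> 1" for c
  proof -
    have "Min (c_disjointness Q N c ` L) \<le> c_disjointness Q N c G"
      using finite_logicals G by (intro Min_le) auto
    also have "\<dots> \<le> real (card G)"
    proof -
      obtain A where A: "A \<subseteq> G" "c_disjointness Q N c G = real (card A) / real c"
        using c_disjointness_attained[of G] finite_coset u by metis
      have "real (card A) / real c \<le> real (card A)"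
        using that by (simp add: divide_le_eq mult_le_cancel_left1)
      also have "card A \<le> card G" using A finite_coset u by (intro card_mono) auto
      finally show ?thesis using A by simp
    qed
    finally show ?thesis .
  qed
  have "0 \<le> Min (c_disjointness Q N 1 ` L)"
    using finite_logicals logicals_nonempty by (subst Min_ge_iff) (auto simp: c_disjointness_def)
  also have "\<dots> \<le> disjointness Q N L"
    unfolding disjointness_def
    by (rule cSUP_upper) (use ub in \<open>auto intro!: bdd_aboveI[of _ "real (card G)"]\<close>)
  finally show ?thesis .
qed

text \<open>Averaging over an optimal \<open>c\<close>-disjoint set: some representative meets \<open>R\<close> in at most
  \<open>|R| / \<Delta>\<close> blocks. The representative with the smallest overlap serves all \<open>c\<close> at once,
  so the supremum over \<open>c\<close> need not be known to be attained.\<close>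

lemma small_overlap:
  assumes "u \<noteq> 0" "R \<subseteq> {1..N}"
  shows "\<exists>g\<in>coset u. real (card (supp Q N g \<inter> R)) * disjointness Q N L \<le> real (card R)"
proof -
  have R: "finite R" using assms(2) by (rule finite_subset) simp
  let ?I = "(\<lambda>g. card (supp Q N g \<inter> R)) ` coset u"
  have fin: "finite ?I" using finite_coset by simp
  have "Min ?I \<in> ?I" using fin coset_nonempty by (intro Min_in) auto
  then obtain g where g: "g \<in> coset u" "card (supp Q N g \<inter> R) = Min ?I" by auto
  have bound: "real (Min ?I) * Min (c_disjointness Q N c ` L) \<le> real (card R)" if c: "c \<ge> 1" for c
  proof -
    obtain A where A: "A \<subseteq> coset u" "c_disjoint Q N c A"
      "c_disjointness Q N c (coset u) = real (card A) / real c"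
      using c_disjointness_attained[OF finite_coset] .
    have fA: "finite A" using A(1) finite_coset finite_subset by blast
    have "Min ?I \<le> card (supp Q N a \<inter> R)" if "a \<in> A" for a
      using that A(1) fin by (intro Min_le) auto
    then have "card A * Min ?I \<le> (\<Sum>a\<in>A. card (supp Q N a \<inter> R))"
      using sum_bounded_below[of A "Min ?I" "\<lambda>a. card (supp Q N a \<inter> R)"] by simp
    also have "\<dots> = (\<Sum>i\<in>R. card {a \<in> A. i \<in> supp Q N a})"
      by (rule double_count_overlap[OF fA R])
    also have "\<dots> \<le> card R * c"
      using sum_bounded_above[of R "\<lambda>i. card {a \<in> A. i \<in> supp Q N a}" c] A(2) assms(2)
      by (auto simp: c_disjoint_def)
    finally have *: "real (card A * Min ?I) \<le> real (card R * c)" by (simp only: of_nat_le_iff)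
    have "real (Min ?I) * Min (c_disjointness Q N c ` L) \<le> real (Min ?I) * (real (card A) / real c)"
      unfolding A(3)[symmetric]
      using finite_logicals coset_in_logicals[OF assms(1)] by (intro mult_left_mono Min_le) auto
    also have "\<dots> = real (card A * Min ?I) / real c" by simp
    also have "\<dots> \<le> real (card R * c) / real c" using * c by (intro divide_right_mono) auto
    also have "\<dots> = real (card R)" using c by simp
    finally show ?thesis .
  qed
  have "real (Min ?I) * disjointness Q N L \<le> real (card R)"
  proof (cases "Min ?I = 0")
    case True
    then show ?thesis by (simp only: of_nat_0 mult_zero_left of_nat_0_le_iff)
  next
    case False
    then have pos: "real (Min ?I) > 0" by linarith
    have "disjointness Q N L \<le> real (card R) / real (Min ?I)"
      unfolding disjointness_def
    proof (rule cSUP_least)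
      fix c :: nat assume "c \<in> {1..}"
      then show "Min (c_disjointness Q N c ` L) \<le> real (card R) / real (Min ?I)"
        using bound[of c] pos by (simp only: pos_le_divide_eq mult.commute atLeast_iff)
    qed simp
    then show ?thesis using pos by (simp only: pos_le_divide_eq mult.commute)
  qed
  then show ?thesis using g by (intro bexI[of _ g]) simp_all
qed

section \<open>The descent for a fixed identification\<close>

context
  fixes V :: "complex ^ ('k \<Rightarrow> 'm mod_ring) ^ ('n \<Rightarrow> 'm mod_ring)"
  assumes V: "code_identification S Xb Zb V"
begin

text \<open>In the commuting case the operator lies, up to phase, in some \<open>coset u\<close>.
  Its small support excludes nonzero u, and \<open>coset 0\<close> acts on the code by
  phases.\<close>

lemma weyl_below_distance_scalar:
  assumes "card (supp Q N (weyl v)) < min_distance Q N L"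
  shows "\<exists>c. dagger V ** weyl v ** V = mat c"
proof (cases "\<forall>s\<in>S. weyl v ** s = s ** weyl v")
  case False
  then have "dagger V ** weyl v ** V = 0" using compress_not_commuting[OF V] by blast
  then show ?thesis by (intro exI[of _ 0]) (simp add: vec_eq_iff mat_vec_index)
next
  case True
  then obtain u g where g: "g \<in> coset u" "weyl v \<sim>\<^sub>p g" using centralizer[OF V] by blast
  have "u = 0"
    using min_distance_le[OF _ g(1)] assms supp_phase[OF g(2), of Q N] by fastforce
  then have "g ** V \<sim>\<^sub>p V ** mat 1"
    using represents_coset[OF V g(1)] by (simp add: represents_def[OF V])
  then have "weyl v ** V \<sim>\<^sub>p V"
    using phase_eq_trans[OF phase_eq_mult[OF g(2) phase_eq_refl]] by simp
  then obtain c where "weyl v ** V = mat c ** V" by (auto simp: phase_eq_def)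
  then have "dagger V ** weyl v ** V = mat c ** (dagger V ** V)"
    by (simp add: matrix_mul_assoc[symmetric] mult_mat_left[of "dagger V"])
  then show ?thesis by (auto simp: V_isometry[OF V])
qed

lemma below_distance_scalar:
  assumes "E ** V = V ** B" "card (supp Q N E) < min_distance Q N L"
  shows "\<exists>c. B = mat c"
proof -
  have "\<exists>c. dagger V ** E ** V = mat c"
  proof (induction E rule: weyl_expansion_induct)
    case 1
    show ?case by (intro exI[of _ 0]) (simp add: vec_eq_iff mat_vec_index)
  next
    case (2 A B)
    then obtain a b where "dagger V ** A ** V = mat a" "dagger V ** B ** V = mat b" by blast
    then show ?case
      by (intro exI[of _ "a + b"]) (auto simp: matrix_add_ldistrib add_matrix_mult vec_eq_iff mat_vec_index)
  next
    case (3 c u)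
    have "card (supp Q N (weyl u)) \<le> card (supp Q N E)"
      by (rule card_mono[OF finite_supp supp_weyl_coeff[OF 3]])
    then obtain d where "dagger V ** weyl u ** V = mat d"
      using weyl_below_distance_scalar assms(2) by fastforce
    then have "dagger V ** (mat c ** weyl u) ** V = mat (c * d)"
      by (simp add: mult_mat_left[of "dagger V"] mat_mult_assoc mat_mult_mat)
    then show ?case by blast
  qed
  moreover have "dagger V ** E ** V = B"
    by (simp add: matrix_mul_assoc[symmetric] assms(1)) (simp add: matrix_mul_assoc V_isometry[OF V])
  ultimately show ?thesis by simp
qed

text \<open>One descent step: any representative g realizes the logical commutator with
  \<open>weyl u\<close>, so g can be chosen for its overlap alone. The phase relating g to
  \<open>weyl u\<close> cancels in the commutator.\<close>

lemma coset_comm: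
  assumes "block_preserving Q N K" "unitary B" "K ** V = V ** B" and g: "g \<in> coset u"
  shows "block_preserving Q N (group_comm K g)"
    and "group_comm K g ** V = V ** group_comm B (weyl u)"
    and "supp Q N (group_comm K g) \<subseteq> supp Q N K \<inter> supp Q N g"
proof -
  obtain v where v: "g \<sim>\<^sub>p weyl v" using coset_phase[OF g] by blast
  show "block_preserving Q N (group_comm K g)"
    by (rule block_preserving_comm[OF assms(1) block_preserving_phase_weyl[OF v]])
  show "supp Q N (group_comm K g) \<subseteq> supp Q N K \<inter> supp Q N g"
    by (rule supp_comm[OF assms(1) v])
  obtain c where c: "cmod c = 1" "g ** V = mat c ** (V ** weyl u)"
    using represents_coset[OF V g] by (auto simp: represents_def[OF V] phase_eq_def)
  have "group_comm K g ** V = V ** group_comm B (mat c ** weyl u)"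
  proof (rule intertwine_comm)
    show "g ** V = V ** (mat c ** weyl u)" by (simp only: c mult_mat_left)
  qed (use assms block_preserving_unitary phase_eq_unitary[OF v] c(1) in
      \<open>auto intro: unitary_mult unitary_mat\<close>)
  then show "group_comm K g ** V = V ** group_comm B (weyl u)"
    by (simp add: group_comm_mat c(1))
qed

text \<open>Each commutator spends one factor Delta, hence exponent \<open>Suc M\<close> for level
  \<open>Suc M\<close>. At M = 0 the one factor left pays for the last commutator, whose support
  falls below the min-distance.\<close>

lemma small_support_clifford:
  assumes "block_preserving Q N K" "unitary B" "K ** V = V ** B"
    and "real (card (supp Q N K)) < real (min_distance Q N L) * disjointness Q N L ^ Suc M"
  shows "B \<in> clifford_level y (Suc M)"
  using assms
proof (induction M arbitrary: K B)
  case base: 0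
  show ?case
  proof (rule clifford_level_1I[OF base(2)])
    fix p :: "('k, 'm) qop" assume "p \<in> pauli_group y"
    then obtain u where p: "p \<sim>\<^sub>p weyl u" using pauli_group_phase by blast
    have "\<exists>c. group_comm B (weyl u) = mat c"
    \<comment> \<open>The trivial logical Pauli has no class in L, so distances and disjointness say
      nothing about it.\<close>
    proof (cases "u = 0")
      case True
      then show ?thesis using base(2) by (intro exI[of _ 1]) (simp add: group_comm_def unitaryD)
    next
      case False
      \<comment> \<open>A zero disjointness would make the right-hand side of the strict bound
        zero.\<close>
      have pos: "disjointness Q N L > 0"
        using base(4) disjointness_nonneg by (cases "disjointness Q N L = 0") auto
      obtain g where g: "g \<in> coset u"
        "real (card (supp Q N g \<inter> supp Q N K)) * disjointness Q N L \<le> real (card (supp Q N K))"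
        using small_overlap[OF False supp_subset] by blast
      have "card (supp Q N (group_comm K g)) \<le> card (supp Q N g \<inter> supp Q N K)"
        using coset_comm(3)[OF base(1,2,3) g(1)] by (intro card_mono) auto
      moreover have "real (card (supp Q N g \<inter> supp Q N K)) * disjointness Q N L
          < real (min_distance Q N L) * disjointness Q N L"
        using g(2) base(4) by simp
      then have "card (supp Q N g \<inter> supp Q N K) < min_distance Q N L"
        using pos by simp
      ultimately show ?thesis
        using below_distance_scalar[OF coset_comm(2)[OF base(1,2,3) g(1)]] by simp
    qed
    then show "\<exists>c. group_comm B p = mat c"
      using group_comm_phase[OF phase_eq_refl p, of B] by simp
  qed
next
  case (Suc M)
  have "group_comm B p \<in> clifford_level y (Suc M)" if "p \<in> pauli_group y" for p
  proof -
    obtain u where p: "p \<sim>\<^sub>p weyl u" using pauli_group_phase \<open>p \<in> pauli_group y\<close> by blast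
    have "group_comm B (weyl u) \<in> clifford_level y (Suc M)"
    proof (cases "u = 0")
      case True
      then have "group_comm B (weyl u) = mat 1" using Suc.prems(2) by (simp add: group_comm_def unitaryD)
      then show ?thesis using clifford_level_one by simp
    next
      case False
      have pos: "disjointness Q N L > 0"
        using Suc.prems(4) disjointness_nonneg by (cases "disjointness Q N L = 0") auto
      obtain g where g: "g \<in> coset u"
        "real (card (supp Q N g \<inter> supp Q N K)) * disjointness Q N L \<le> real (card (supp Q N K))"
        using small_overlap[OF False supp_subset] by blast
      have "real (card (supp Q N (group_comm K g))) \<le> real (card (supp Q N g \<inter> supp Q N K))"
        using coset_comm(3)[OF Suc.prems(1-3) g(1)] by (intro of_nat_mono card_mono) auto
      moreover have "real (card (supp Q N g \<inter> supp Q N K)) * disjointness Q N L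
          < (real (min_distance Q N L) * disjointness Q N L ^ Suc M) * disjointness Q N L"
        using g(2) Suc.prems(4) by (simp add: mult_ac)
      then have "real (card (supp Q N g \<inter> supp Q N K)) < real (min_distance Q N L) * disjointness Q N L ^ Suc M"
        by (rule mult_right_less_imp_less) (use pos in simp)
      ultimately have "real (card (supp Q N (group_comm K g))) < real (min_distance Q N L) * disjointness Q N L ^ Suc M"
        by (rule le_less_trans)
      moreover have "unitary (group_comm B (weyl u))" using Suc.prems(2) by (simp add: unitary_comm)
      ultimately show ?thesis
        using Suc.IH coset_comm(1,2)[OF Suc.prems(1-3) g(1)] by blast
    qed
    then show ?thesis using group_comm_phase[OF phase_eq_refl p, of B] by simp
  qed
  then show ?case using Suc.prems(2) by simp
qed

text \<open>The first commutator is bounded by the support of g alone and spends no factor Delta, so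
  the level exceeds the exponent by one.\<close>

lemma transversal_logical_clifford:
  assumes "block_preserving Q N U" "logical_operator S U"
    and "real (max_distance Q N L) < real (min_distance Q N L) * disjointness Q N L ^ Suc M"
  shows "dagger V ** U ** V \<in> clifford_level y (Suc (Suc M))"
proof -
  define B where "B = dagger V ** U ** V"
  have UV: "U ** V = V ** B"
    unfolding B_def using assms(2) by (intro V_compress[OF V]) (simp add: logical_operator_def)
  have U: "unitary U" using assms(2) by (simp add: logical_operator_def)
  have B: "unitary B"
  proof (rule unitaryI)
    have "dagger B ** B = dagger (V ** B) ** (V ** B)"
      by (simp add: dagger_mult matrix_mul_assoc[symmetric])
         (simp add: matrix_mul_assoc[of "dagger V"] V_isometry[OF V])
    also have "\<dots> = dagger V ** (dagger U ** (U ** V))"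
      by (simp add: UV[symmetric] dagger_mult matrix_mul_assoc[symmetric])
    finally show "dagger B ** B = mat 1" by (simp add: cancel_dagger[OF U] V_isometry[OF V])
  qed
  have "group_comm B p \<in> clifford_level y (Suc M)" if "p \<in> pauli_group y" for p
  proof -
    obtain u where p: "p \<sim>\<^sub>p weyl u" using pauli_group_phase \<open>p \<in> pauli_group y\<close> by blast
    have "group_comm B (weyl u) \<in> clifford_level y (Suc M)"
    proof (cases "u = 0")
      case True
      then have "group_comm B (weyl u) = mat 1" using B by (simp add: group_comm_def unitaryD)
      then show ?thesis using clifford_level_one by simp
    next
      case False
      then obtain g where g: "g \<in> coset u" "card (supp Q N g) \<le> max_distance Q N L"
        using max_distance_ge by blast
      have "card (supp Q N (group_comm U g)) \<le> card (supp Q N g)"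
        using coset_comm(3)[OF assms(1) B UV g(1)] by (intro card_mono) auto
      then have "real (card (supp Q N (group_comm U g))) < real (min_distance Q N L) * disjointness Q N L ^ Suc M"
        using g(2) assms(3) by linarith
      moreover have "unitary (group_comm B (weyl u))" using B by (simp add: unitary_comm)
      ultimately show ?thesis
        using small_support_clifford coset_comm(1,2)[OF assms(1) B UV g(1)] by blast
    qed
    then show ?thesis using group_comm_phase[OF phase_eq_refl p, of B] by simp
  qed
  then show ?thesis using B by (simp add: B_def[symmetric])
qed

end

end

end

theorem theorem5:
  fixes y :: bool
    and S :: "('n::finite, 'm::nontriv) qop set"
    and Xb Zb :: "'k::finite \<Rightarrow> ('n, 'm) qop"
    and Q :: "nat \<Rightarrow> 'n set"
    and N M :: nat
    and U :: "('n, 'm) qop"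
  defines "L \<equiv> nontrivial_logical_paulis S Xb Zb"
  assumes "stabilizer_code y S CARD('k)"
    and "logical_generators y S Xb Zb"
    and "qudit_partition Q N"
    and "M \<ge> 1"
    and "real (max_distance Q N L) < real (min_distance Q N L) * disjointness Q N L ^ (M - 1)"
    and "transversal Q N U"
    and "logical_operator S U"
  shows "U \<in> logical_clifford_level y S Xb Zb M"
proof -
  interpret stabilizer_code_with_logicals y S Xb Zb
    by standard fact+
  have bp: "block_preserving Q N U"
    using assms(4,7) by (intro transversal_block_preserving) (auto simp: qudit_partition_def)
  \<comment> \<open>For M = 1 the hypothesis would say d_up < d_down, which never holds; the descent
    starts at level 2.\<close>
  have "M \<noteq> 1"
    using assms(6) min_le_max_distance[of Q N] by (auto simp: L_def)
  then obtain M' where M': "M = Suc (Suc M')"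
    using assms(5) by (metis One_nat_def not0_implies_Suc not_one_le_zero)
  have "dagger V ** U ** V \<in> clifford_level y M" if "code_identification S Xb Zb V" for V
    unfolding M' using assms(6) M' by (intro transversal_logical_clifford[OF that bp assms(8)]) (simp add: L_def)
  then show ?thesis
    using assms(8) identification_exists by (simp add: logical_clifford_level_def)
qed

end
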